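(* Let $M_n^{(\beta)}$ denote the unnormalised magnetisation of the Curie-Weiss model with $n$ spins at inverse temperature $\beta\ge 0$ (and zero external field). Then the following convergences in law hold as $n\to+\infty$. 1. If $\beta<1$, then $\frac{1}{\sqrt n}M_n^{(\beta)}$ converges in law to $\mathcal N\left(0,\frac{1}{1-\beta}\right)$. 2. If $\beta=1$, then $\frac{1}{n^{3/4}}M_n^{(1)}$ converges in law to a random variable $F_0$ with law $\frac{1}{\mathcal Z_0}e^{-x^4/12}\,dx$ on $\mathbb R$, where $\mathcal Z_0$ is the normalising constant; moreover $F_0$ has the same law as $B_{\pm1}\,(12\,\boldsymbol\gamma(1/4))^{1/4}$, where $\boldsymbol\gamma(1/4)$ has the Gamma law of parameter $1/4$, $B_{\pm 1}$ is uniform on $\{-1,1\}$, and $B_{\pm1}$ and $\boldsymbol\gamma(1/4)$ are independent. 3. If $\beta=\beta_n=1-\frac{\gamma}{\sqrt n}$ with $\gamma\in\mathbb R$ fixed (and $n$ large enough that $\beta_n> 0$), then $\frac{1}{n^{3/4}}M_n^{(\beta_n)}$ converges in law to a random variable $F_\gamma$ with law $\frac{1}{\mathcal Z_\gamma}e^{-\gamma x^2/2-x^4/12}\,dx$ on $\mathbb R$, where $\mathcal Z_\gamma$ is the normalising constant. 4. If $\beta>1$, then $\frac1n M_n^{(\beta)}$ converges in law to $t_\beta\,\boldsymbol B$, where $\boldsymbol B$ is uniform on $\{-1,1\}$ and $t_\beta$ is the unique positive solution of $t_\beta=\tanh(\beta t_\beta)$.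
   Context: Let $X_1,\dots,X_n$ be i.i.d. uniform on $\{-1,1\}$ and $S_n=\sum_{k=1}^n X_k$. For $\beta\ge0$, the Curie-Weiss model with $n$ spins at inverse temperature $\beta$ is the law of the vector $(X_1^{(\beta)},\dots,X_n^{(\beta)})\in\{-1,1\}^n$ whose density with respect to the law of $(X_1,\dots,X_n)$ is $e^{\frac{\beta}{2n}S_n^2}/\mathbb E\left(e^{\frac{\beta}{2n}S_n^2}\right)$. The unnormalised magnetisation is $M_n^{(\beta)}=\sum_{k=1}^nX_k^{(\beta)}$. The Gamma law of parameter $a>0$ is the law on $(0,\infty)$ with density proportional to $x^{a-1}e^{-x}$. *)

theory Defs
  imports "HOL-Probability.Probability"
begin

text \<open>
  Convergence in law on the real line is the library notion \<^const>\<open>weak_conv_m\<close>, applied to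
  the laws of the random variables on \<^term>\<open>borel :: real measure\<close>.
\<close>

definition uniform_sign :: "real measure" where
  "uniform_sign = distr (measure_pmf (pmf_of_set {-1, 1})) borel (\<lambda>x. x)"

definition magnetisation :: "nat \<Rightarrow> (nat \<Rightarrow> real) \<Rightarrow> real" where
  "magnetisation n x = (\<Sum>k=1..n. x k)"

text \<open>
  Law of \<open>(X\<^sub>1, \<dots>, X\<^sub>n)\<close> for i.i.d. \<open>X\<^sub>k\<close> uniform on \<open>{-1, 1}\<close>. Vectors are functions on the
  index set \<open>{1..n}\<close>.
\<close>
definition free_spins :: "nat \<Rightarrow> (nat \<Rightarrow> real) measure" where
  "free_spins n = Pi\<^sub>M {1..n} (\<lambda>_. uniform_sign)"

definition gibbs_weight :: "nat \<Rightarrow> real \<Rightarrow> (nat \<Rightarrow> real) \<Rightarrow> real" where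
  "gibbs_weight n \<beta> x = exp (\<beta> / (2 * real n) * (magnetisation n x)\<^sup>2)"

text \<open>
  The formula makes sense for every real \<open>\<beta>\<close>, but is the Curie-Weiss model for \<open>\<beta> \<ge> 0\<close>
  and \<open>n \<ge> 1\<close> only.
\<close>
definition curie_weiss :: "nat \<Rightarrow> real \<Rightarrow> (nat \<Rightarrow> real) measure" where
  "curie_weiss n \<beta> = density (free_spins n)
     (\<lambda>x. ennreal (gibbs_weight n \<beta> x / (\<integral>y. gibbs_weight n \<beta> y \<partial>free_spins n)))"

text \<open>
  The probability measure on the reals with Lebesgue density proportional to \<open>f\<close>. This is meaningful
  for nonnegative integrable \<open>f\<close> with nonzero integral (see \<open>prob_space_normalised_law\<close> below);
  otherwise the integral may be the junk value 0.
\<close>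
definition normalised_law :: "(real \<Rightarrow> real) \<Rightarrow> real measure" where
  "normalised_law f = density lborel (\<lambda>x. ennreal (f x / (\<integral>y. f y \<partial>lborel)))"

definition gamma_law :: "real \<Rightarrow> real measure" where
  "gamma_law a = normalised_law (\<lambda>x. indicator {0<..} x * (x powr (a - 1) * exp (- x)))"

definition quartic_law :: "real \<Rightarrow> real measure" where
  "quartic_law \<gamma> = normalised_law (\<lambda>x. exp (- \<gamma> * x ^ 2 / 2 - x ^ 4 / 12))"

text \<open>Meaningful for \<open>\<beta> > 1\<close>, where the equation has exactly one positive solution.\<close>
definition tanh_root :: "real \<Rightarrow> real" where
  "tanh_root \<beta> = (THE t. 0 < t \<and> t = tanh (\<beta> * t))"

lemma prob_space_normalised_law:
  assumes "integrable lborel f" "\<And>x. 0 \<le> f x" "(\<integral>x. f x \<partial>lborel) \<noteq> 0"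
  shows "prob_space (normalised_law f)"
proof -
  let ?Z = "\<integral>x. f x \<partial>lborel"
  have Z: "?Z > 0"
    using assms(2,3) by (simp add: less_le)
  have "(\<integral>\<^sup>+x. ennreal (f x / ?Z) \<partial>lborel) = ennreal (\<integral>x. f x / ?Z \<partial>lborel)"
    using assms Z by (intro nn_integral_eq_integral) auto
  also have "\<dots> = 1"
    using Z by simp
  finally show ?thesis
    unfolding normalised_law_def using assms(1)
    by (intro prob_spaceI) (simp add: emeasure_density)
qed

lemma integral_pos_imp_nonzero:
  fixes f :: "real \<Rightarrow> real"
  assumes "integrable lborel f" "\<And>x. 0 \<le> f x" "\<And>x. 0 < x \<Longrightarrow> 0 < f x"
  shows "(\<integral>x. f x \<partial>lborel) \<noteq> 0"
proof
  assume "(\<integral>x. f x \<partial>lborel) = 0"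
  then have "AE x in lborel. f x = 0"
    using assms integral_nonneg_eq_0_iff_AE[of lborel f] by simp
  then have "AE x in lborel. x \<notin> {0<..(1::real)}"
    by eventually_elim (use assms(3) in force)
  then have "emeasure lborel {0<..(1::real)} = 0"
    by (subst (asm) AE_iff_measurable[of "{0<..1}"]) auto
  then show False by simp
qed

lemma prob_space_gamma_law:
  assumes "a > 0"
  shows "prob_space (gamma_law a)"
proof -
  let ?g = "\<lambda>x::real. indicator {0<..} x * (x powr (a - 1) * exp (- x))"
  have "(\<integral>\<^sup>+x. ennreal (?g x) \<partial>lborel)
      \<le> (\<integral>\<^sup>+x. ennreal (indicator {0..} x * x powr (a - 1) / exp x) \<partial>lborel)"
    by (intro nn_integral_mono) (auto simp: indicator_def exp_minus field_simps)
  also have "\<dots> = ennreal (Gamma a)"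
    using assms by (rule Gamma_conv_nn_integral_real[symmetric])
  also have "\<dots> < \<infinity>"
    by simp
  finally have "integrable lborel ?g"
    by (intro integrableI_nonneg) auto
  then show ?thesis
    unfolding gamma_law_def
    by (intro prob_space_normalised_law integral_pos_imp_nonzero) auto
qed

lemma prob_space_quartic_law: "prob_space (quartic_law \<gamma>)"
proof -
  let ?f = "\<lambda>x::real. exp (- \<gamma> * x ^ 2 / 2 - x ^ 4 / 12)"
  let ?C = "exp (3 * (1 - \<gamma>)\<^sup>2 / 4) * sqrt (2 * pi)"
  have "integrable lborel ?f"
  proof (rule Bochner_Integration.integrable_bound)
    show "integrable lborel (\<lambda>x. ?C * normal_density 0 1 x)"
      by simp
    show "AE x in lborel. norm (?f x) \<le> norm (?C * normal_density 0 1 x)"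
    proof (intro AE_I2)
      fix x :: real
      have "0 \<le> (x\<^sup>2 - 3 * (1 - \<gamma>))\<^sup>2 / 12" by simp
      also have "\<dots> = x ^ 4 / 12 - (1 - \<gamma>) * x\<^sup>2 / 2 + 3 * (1 - \<gamma>)\<^sup>2 / 4"
        by (simp add: power2_eq_square power4_eq_xxxx field_simps)
      finally have "- \<gamma> * x ^ 2 / 2 - x ^ 4 / 12 \<le> 3 * (1 - \<gamma>)\<^sup>2 / 4 + - x\<^sup>2 / 2"
        by (simp add: field_simps)
      then have "?f x \<le> exp (3 * (1 - \<gamma>)\<^sup>2 / 4) * exp (- x\<^sup>2 / 2)"
        by (simp flip: exp_add)
      then show "norm (?f x) \<le> norm (?C * normal_density 0 1 x)"
        by (simp add: std_normal_density_def abs_mult)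
    qed
  qed measurable
  then show ?thesis
    unfolding quartic_law_def
    by (intro prob_space_normalised_law integral_pos_imp_nonzero) auto
qed

lemma prob_space_uniform_sign: "prob_space uniform_sign"
  unfolding uniform_sign_def
  by (intro prob_space.prob_space_distr measure_pmf.prob_space_axioms) auto

lemma prob_space_free_spins: "prob_space (free_spins n)"
  unfolding free_spins_def by (intro prob_space_PiM prob_space_uniform_sign)

lemma sets_free_spins: "sets (free_spins n) = sets (Pi\<^sub>M {1..n} (\<lambda>_. borel))"
  unfolding free_spins_def by (intro sets_PiM_cong) (auto simp: uniform_sign_def)

lemma measurable_magnetisation: "magnetisation n \<in> borel_measurable (free_spins n)"
proof -
  have "magnetisation n \<in> borel_measurable (Pi\<^sub>M {1..n} (\<lambda>_. borel))"
    unfolding magnetisation_def by measurable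
  then show ?thesis
    using measurable_cong_sets[OF sets_free_spins refl] by blast
qed

lemma AE_free_spins: "AE x in free_spins n. \<forall>k\<in>{1..n}. \<bar>x k\<bar> = 1"
proof -
  interpret prob_space uniform_sign by (rule prob_space_uniform_sign)
  have "AE y in uniform_sign. \<bar>y\<bar> = 1"
    unfolding uniform_sign_def by (subst AE_distr_iff) (auto simp: AE_measure_pmf_iff)
  then have "AE x in free_spins n. \<bar>x k\<bar> = 1" if "k \<in> {1..n}" for k
    unfolding free_spins_def using that
    by (intro AE_PiM_component prob_space_uniform_sign)
  then show ?thesis
    by (intro AE_finite_allI) auto
qed

lemma integrable_gibbs_weight: "integrable (free_spins n) (gibbs_weight n \<beta>)"
proof -
  interpret prob_space "free_spins n" by (rule prob_space_free_spins)
  have "AE x in free_spins n. norm (gibbs_weight n \<beta> x) \<le> exp (\<bar>\<beta> / (2 * real n)\<bar> * (real n)\<^sup>2)"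
    using AE_free_spins[of n]
  proof eventually_elim
    case (elim x)
    have "\<bar>magnetisation n x\<bar> \<le> (\<Sum>k=1..n. \<bar>x k\<bar>)"
      unfolding magnetisation_def by (rule sum_abs)
    then have "(magnetisation n x)\<^sup>2 \<le> (real n)\<^sup>2"
      using elim by (simp flip: abs_le_square_iff)
    then have "\<beta> / (2 * real n) * (magnetisation n x)\<^sup>2 \<le> \<bar>\<beta> / (2 * real n)\<bar> * (real n)\<^sup>2"
      by (intro mult_mono abs_ge_self) auto
    then show ?case by (simp add: gibbs_weight_def)
  qed
  then show ?thesis
    using measurable_magnetisation[of n]
    by (intro integrable_const_bound) (auto simp: gibbs_weight_def[abs_def])
qed

lemma prob_space_curie_weiss: "prob_space (curie_weiss n \<beta>)"
proof -
  interpret prob_space "free_spins n" by (rule prob_space_free_spins)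
  let ?Z = "\<integral>y. gibbs_weight n \<beta> y \<partial>free_spins n"
  have pos: "gibbs_weight n \<beta> x > 0" for x
    by (simp add: gibbs_weight_def)
  then have nonneg: "gibbs_weight n \<beta> x \<ge> 0" for x
    by (rule less_imp_le)
  have "?Z \<noteq> 0"
  proof
    assume "?Z = 0"
    then have "AE x in free_spins n. gibbs_weight n \<beta> x = 0"
      using integral_nonneg_eq_0_iff_AE[OF integrable_gibbs_weight] nonneg by simp
    then have "AE x in free_spins n. False"
      by eventually_elim (use pos in \<open>simp add: less_le\<close>)
    then show False by simp
  qed
  moreover have "?Z \<ge> 0"
    using nonneg by (intro integral_nonneg_AE) auto
  ultimately have Z: "?Z > 0" by simp
  have "(\<integral>\<^sup>+x. ennreal (gibbs_weight n \<beta> x / ?Z) \<partial>free_spins n)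
      = ennreal (\<integral>x. gibbs_weight n \<beta> x / ?Z \<partial>free_spins n)"
    using integrable_gibbs_weight Z nonneg
    by (intro nn_integral_eq_integral) auto
  also have "\<dots> = 1"
    using Z by simp
  finally show ?thesis
    unfolding curie_weiss_def using integrable_gibbs_weight[of n \<beta>]
    by (intro prob_spaceI) (simp add: emeasure_density)
qed

end

theory Submission
  imports Defs "HOL-Real_Asymp.Real_Asymp"
begin

text \<open>
  The square in the Gibbs weight is linearised by a Gaussian: if \<open>n b\<^sup>2 = 2 \<beta> \<kappa>\<close>, then
  \<open>exp (\<beta> s\<^sup>2 / (2 n))\<close> is, up to a constant factor, the integral over \<open>x\<close> of
  \<open>exp (b x s - \<kappa> x\<^sup>2)\<close> (the Hubbard-Stratonovich transform). Given the auxiliary field \<open>x\<close> the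
  spins are independent with mean \<open>tanh (b x)\<close>, so the characteristic function of the rescaled
  magnetisation \<open>M / a\<close> at \<open>t\<close> is the mean of \<open>(cos s + \<i> tanh (b x) sin s) ^ n\<close>, \<open>s = t / a\<close>, under the
  density proportional to \<open>cosh (b x) ^ n exp (- \<kappa> x\<^sup>2)\<close>; this is \<open>char_curie_weiss\<close>. All four limits in
  law are now limits of one-dimensional integrals, and Levy's continuity theorem turns the pointwise
  convergence of characteristic functions into convergence in law.

  For \<open>\<beta> < 1\<close> and in the window \<open>\<beta> = 1 - \<gamma> / sqrt n\<close>, the scale \<open>b\<close> (of order \<open>n\<close> to the power \<open>- 1 / 2\<close>
  and \<open>- 1 / 4\<close> respectively) is chosen so that the density converges pointwise without further
  rescaling. The logarithm of the weight is \<open>n (ln cosh u - u\<^sup>2 / 2)\<close>, \<open>u = b x\<close>, plus a quadratic in \<open>x\<close>.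
  Since \<open>ln cosh u = u\<^sup>2 / 2 - u ^ 4 / 12 + \<dots>\<close>, only the quadratic survives for \<open>\<beta> < 1\<close>, and the
  quartic term appears exactly when \<open>n b ^ 4\<close> does not vanish. The exchange of limit and integral rests on the
  global inequality \<open>ln_cosh_upper\<close>, which keeps the quartic gain near \<open>0\<close> and a quadratic gain
  at infinity. For \<open>\<beta> < 1\<close> the conditional mean
  \<open>n tanh (b x)\<close> and the fluctuations of the spins around it are both of order \<open>sqrt n\<close>: after rescaling, their
  variances \<open>\<beta> / (1 - \<beta>)\<close> and \<open>1\<close> add up to \<open>1 / (1 - \<beta>)\<close>. In the critical window the conditional mean is of
  order \<open>n powr (3 / 4)\<close> and the fluctuations around it disappear.

  For \<open>\<beta> > 1\<close> the field is not rescaled (\<open>b = 1\<close>) and its density is \<open>exp (n h)\<close> with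
  \<open>h x = ln cosh x - x\<^sup>2 / (2 \<beta>)\<close>, which is even and maximal exactly at the two points \<open>u\<close>, \<open>- u\<close>, where
  \<open>u > 0\<close> and \<open>tanh u = u / \<beta>\<close>. Laplace's method concentrates the field there, and \<open>M / n\<close> is close to \<open>tanh x\<close>.

  The representation of the quartic law by a Gamma variable is the substitution \<open>y = x ^ 4 / 12\<close>
  on the half-line, followed by a random sign.
\<close>

section \<open>Hyperbolic and trigonometric estimates\<close>

lemma le_sinh_real:
  fixes x :: real
  assumes "0 \<le> x"
  shows "x \<le> sinh x"
proof -
  have "sinh 0 - 0 \<le> sinh x - x"
  proof (rule DERIV_nonneg_imp_nondecreasing[OF assms])
    fix v :: real
    show "\<exists>y. ((\<lambda>v. sinh v - v) has_real_derivative y) (at v) \<and> 0 \<le> y"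
      by (rule exI[of _ "cosh v - 1"]) (auto intro!: derivative_eq_intros simp: cosh_real_ge_1)
  qed
  then show ?thesis by simp
qed

text \<open>
  Written in terms of \<open>sinh\<close>, the right-hand side is \<open>v / (1 + v)\<close> at \<open>v = (sinh u)\<^sup>2 \<ge> u\<^sup>2\<close>, and
  \<open>v / (1 + v)\<close> increases with \<open>v\<close>.
\<close>
lemma tanh_square_ge:
  fixes u :: real
  shows "u\<^sup>2 / (1 + u\<^sup>2) \<le> (tanh u)\<^sup>2"
proof -
  have "\<bar>u\<bar> \<le> \<bar>sinh u\<bar>"
    using le_sinh_real[of "\<bar>u\<bar>"] by simp
  then have "u\<^sup>2 \<le> (sinh u)\<^sup>2"
    by (simp add: abs_le_square_iff)
  then have "u\<^sup>2 * (1 + (sinh u)\<^sup>2) \<le> (sinh u)\<^sup>2 * (1 + u\<^sup>2)"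
    by (simp add: algebra_simps)
  moreover have "(tanh u)\<^sup>2 = (sinh u)\<^sup>2 / (1 + (sinh u)\<^sup>2)"
    by (simp add: tanh_def power_divide cosh_square_eq add.commute)
  moreover have "a / (1 + a) \<le> b / (1 + b)" if "a * (1 + b) \<le> b * (1 + a)" "0 \<le> a" "0 \<le> b" for a b :: real
  proof -
    have "0 < 1 + a" "0 < 1 + b" using that by auto
    then show ?thesis using that(1)
      by (simp only: frac_le_eq) (smt (verit) divide_nonpos_pos mult_pos_pos)
  qed
  ultimately show ?thesis
    by simp
qed

text \<open>
  The subtracted term is \<open>r' / 12\<close> for \<open>r u = u ^ 4 / (1 + u\<^sup>2)\<close>, and this is the derivative of the
  inequality \<open>ln_cosh_upper\<close>. One more differentiation leaves
  \<open>r'' / 12 \<le> (tanh u)\<^sup>2\<close>, which follows from \<open>tanh_square_ge\<close> because \<open>r'' \<le> 12 u\<^sup>2 / (1 + u\<^sup>2)\<close>.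
\<close>
lemma tanh_le_cubic_correction:
  fixes u :: real
  assumes "0 \<le> u"
  shows "tanh u \<le> u - (u / 6 - u / (6 * (1 + u\<^sup>2)\<^sup>2))"
proof -
  define q where "q v = v - (v / 6 - v / (6 * (1 + v\<^sup>2)\<^sup>2)) - tanh v" for v :: real
  have "q 0 \<le> q u"
  proof (rule DERIV_nonneg_imp_nondecreasing[OF assms])
    fix x :: real
    have p: "0 < 1 + x\<^sup>2" by (simp add: add_pos_nonneg)
    define D where "D = 5/6 + 1 / (6 * (1 + x\<^sup>2)\<^sup>2) - 4 * x\<^sup>2 / (6 * (1 + x\<^sup>2)^3) - (1 - (tanh x)\<^sup>2)"
    have "(q has_real_derivative D) (at x)"
      unfolding q_def D_def using p
      apply (auto intro!: derivative_eq_intros)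
      apply (simp add: field_simps)
      apply algebra
      done
    moreover have "0 \<le> D"
    proof -
      have "1/6 - 1 / (6 * (1 + x\<^sup>2)\<^sup>2) + 4 * x\<^sup>2 / (6 * (1 + x\<^sup>2)^3) \<le> x\<^sup>2 / (1 + x\<^sup>2)"
      proof -
        define w where "w = 1 + x\<^sup>2"
        have w: "1 \<le> w" "x\<^sup>2 = w - 1" by (simp_all add: w_def)
        have "1/6 - 1 / (6 * w\<^sup>2) + 4 * (w - 1) / (6 * w^3) = (w^3 - w + 4 * (w - 1)) / (6 * w^3)"
        proof -
          have "w \<noteq> 0" using w(1) by auto
          then have "1 / (6 * w\<^sup>2) = w / (6 * w^3)" "1/6 = w^3 / (6 * w^3)"
            by (simp_all add: power2_eq_square power3_eq_cube)
          then show ?thesis by (simp only: diff_divide_distrib add_divide_distrib)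
        qed
        also have "\<dots> \<le> (6 * (w - 1) * w^2) / (6 * w^3)"
        proof (rule divide_right_mono)
          have "0 \<le> (w - 1) * ((w - 1) * (5 * w + 4))"
            using w(1) by (intro mult_nonneg_nonneg) auto
          then show "w^3 - w + 4 * (w - 1) \<le> 6 * (w - 1) * w^2"
            by (simp add: power2_eq_square power3_eq_cube algebra_simps)
        qed (use w(1) in simp)
        also have "\<dots> = (w - 1) / w"
        proof -
          have "w \<noteq> 0" using w(1) by simp
          then show ?thesis
            by (simp add: nonzero_divide_eq_eq nonzero_eq_divide_eq power2_eq_square power3_eq_cube)
        qed
        finally show ?thesis unfolding w_def by simp
      qed
      with tanh_square_ge[of x] show ?thesis by (simp add: D_def)
    qed
    ultimately show "\<exists>y. (q has_real_derivative y) (at x) \<and> 0 \<le> y" by blast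
  qed
  then show ?thesis by (simp add: q_def)
qed

text \<open>
  The sharp constant \<open>1 / 12\<close> of the expansion at \<open>0\<close>, in a form valid on the whole line. With
  \<open>u ^ 4\<close> alone the bound would be false for large \<open>u\<close>, where the gain over \<open>u\<^sup>2 / 2\<close> is only quadratic;
  the denominator \<open>1 + u\<^sup>2\<close> accounts for this.
\<close>
lemma ln_cosh_upper:
  fixes u :: real
  shows "ln (cosh u) \<le> u\<^sup>2 / 2 - u ^ 4 / (12 * (1 + u\<^sup>2))"
proof -
  \<comment> \<open>\<open>v ^ 4 / (1 + v\<^sup>2)\<close>, expanded so that its derivative is immediate\<close>
  define q where "q v = v\<^sup>2 / 2 - (v\<^sup>2 - 1 + 1 / (1 + v\<^sup>2)) / 12 - ln (cosh v)" for v :: real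
  have "q 0 \<le> q \<bar>u\<bar>"
  proof (rule DERIV_nonneg_imp_nondecreasing[of 0 "\<bar>u\<bar>"])
    fix x :: real
    assume x: "0 \<le> x"
    have p: "0 < 1 + x\<^sup>2" by (simp add: add_pos_nonneg)
    have "(q has_real_derivative (x - (x / 6 - x / (6 * (1 + x\<^sup>2)\<^sup>2)) - tanh x)) (at x)"
      unfolding q_def using p
      by (auto intro!: derivative_eq_intros simp: tanh_def diff_divide_distrib power2_eq_square[of "1 + x\<^sup>2"])
    then show "\<exists>y. (q has_real_derivative y) (at x) \<and> 0 \<le> y"
      using tanh_le_cubic_correction[OF x] by force
  qed simp
  moreover have "v\<^sup>2 - 1 + 1 / (1 + v\<^sup>2) = v ^ 4 / (1 + v\<^sup>2)" for v :: real
  proof -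
    have "0 < 1 + v\<^sup>2" by (simp add: add_pos_nonneg)
    then show ?thesis by (simp add: field_simps power2_eq_square power4_eq_xxxx)
  qed
  ultimately show ?thesis by (simp add: q_def mult.commute)
qed

lemma tendsto_ln_cosh_quartic: "((\<lambda>u. (ln (cosh u) - u\<^sup>2 / 2) / u ^ 4) \<longlongrightarrow> (- 1 / 12 :: real)) (at 0)"
  by real_asymp

lemma tendsto_cos_quadratic: "((\<lambda>u. (cos u - 1) / u ^ 2) \<longlongrightarrow> (- 1 / 2 :: real)) (at 0)"
  by real_asymp

lemma tendsto_tanh_linear: "((\<lambda>u. tanh u / u ^ 1) \<longlongrightarrow> (1 :: real)) (at 0)"
  by real_asymp

lemma tendsto_sin_linear: "((\<lambda>u. sin u / u ^ 1) \<longlongrightarrow> (1 :: real)) (at 0)"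
  by real_asymp

text \<open>
  If \<open>p v\<close> behaves like \<open>L v ^ k\<close> at \<open>0\<close>, the large prefactors \<open>c i\<close> may be balanced against
  \<open>u i ^ k\<close>. The arguments \<open>u i\<close> may vanish, so \<open>p v / v ^ k\<close> has to be extended continuously to \<open>0\<close>.
\<close>
lemma tendsto_scaled:
  fixes p :: "real \<Rightarrow> real" and u c :: "'a \<Rightarrow> real"
  assumes p: "((\<lambda>v. p v / v ^ k) \<longlongrightarrow> L) (at 0)" "p 0 = 0" "0 < k"
    and u: "(u \<longlongrightarrow> 0) F" and c: "((\<lambda>i. c i * u i ^ k) \<longlongrightarrow> l) F"
  shows "((\<lambda>i. c i * p (u i)) \<longlongrightarrow> l * L) F"
proof -
  define q where "q v = (if v = 0 then L else p v / v ^ k)" for v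
  have "((\<lambda>v. q v) \<longlongrightarrow> L) (at 0)"
    using p(1) by (rule Lim_transform_eventually) (auto simp: q_def eventually_at_filter)
  moreover have "q 0 = L" by (simp add: q_def)
  ultimately have "isCont q 0"
    by (simp add: isCont_def)
  then have "((\<lambda>i. q (u i)) \<longlongrightarrow> L) F"
    using isCont_tendsto_compose[OF _ u, of q] by (simp add: q_def)
  from tendsto_mult[OF c this]
  have "((\<lambda>i. c i * u i ^ k * q (u i)) \<longlongrightarrow> l * L) F" .
  moreover have "c i * u i ^ k * q (u i) = c i * p (u i)" for i
    using p(2,3) by (simp add: q_def)
  ultimately show ?thesis by simp
qed

text \<open>
  \<open>Complex (cos s) (\<tau> * sin s)\<close> is the characteristic function at \<open>s\<close> of a \<open>{-1, 1}\<close>-valued spin with mean \<open>\<tau>\<close>.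
\<close>
lemma norm_tilted_spin_char_le_1:
  fixes s \<tau> :: real
  assumes \<tau>: "\<bar>\<tau>\<bar> \<le> 1"
  shows "norm (Complex (cos s) (\<tau> * sin s)) \<le> 1"
proof -
  have "\<tau>\<^sup>2 \<le> 1" using \<tau> by (simp add: abs_square_le_1)
  then have "(\<tau> * sin s)\<^sup>2 \<le> (sin s)\<^sup>2"
    using mult_right_mono[of "\<tau>\<^sup>2" 1 "(sin s)\<^sup>2"] by (simp add: power_mult_distrib)
  then have "(cos s)\<^sup>2 + (\<tau> * sin s)\<^sup>2 \<le> (cos s)\<^sup>2 + (sin s)\<^sup>2"
    by (rule add_left_mono)
  then show ?thesis by (simp add: cmod_def)
qed

text \<open>
  Poissonisation: for \<open>z\<close> in the closed unit disc, \<open>exp (z - 1)\<close> lies in the disc too, so the \<open>n\<close>-th powers of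
  \<open>z\<close> and \<open>exp (z - 1)\<close> differ by at most \<open>n\<close> times the second order Taylor remainder, which is of order
  \<open>n * (norm (z - 1))\<^sup>2\<close>. For the characteristic function \<open>z\<close> of a spin with mean \<open>\<tau>\<close>, \<open>(norm (z - 1))\<^sup>2\<close> is at most
  \<open>s\<^sup>2 (s\<^sup>2 + \<tau>\<^sup>2)\<close>. The factor \<open>\<tau>\<^sup>2\<close> matters when \<open>s\<close> is only of order \<open>1 / sqrt n\<close>: there
  \<open>n s\<^sup>2\<close> stays bounded and \<open>\<tau> \<longlonglongrightarrow> 0\<close> makes the error vanish.
\<close>
lemma tilted_spin_char_power:
  fixes s \<tau> :: real
  assumes \<tau>: "\<bar>\<tau>\<bar> \<le> 1"
  shows "norm ((Complex (cos s) (\<tau> * sin s)) ^ n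
            - exp (complex_of_real (real n * (cos s - 1))) * cis (real n * \<tau> * sin s))
         \<le> real n * (s\<^sup>2 * (s\<^sup>2 + \<tau>\<^sup>2) * exp 2)"
proof -
  define z where "z = Complex (cos s) (\<tau> * sin s)"
  have z1: "norm z \<le> 1"
    unfolding z_def using \<tau> by (rule norm_tilted_spin_char_le_1)
  have Re: "Re (z - 1) \<le> 0" by (simp add: z_def)
  have "norm (exp (z - 1)) \<le> 1" using Re by simp
  have "norm (z - exp (z - 1)) \<le> exp \<bar>Re (z - 1)\<bar> * norm (z - 1) ^ 2"
    using Taylor_exp[of "z - 1" 1] by (simp add: norm_minus_commute algebra_simps power2_eq_square)
  \<comment> \<open>the constant: \<open>Re (z - 1) = cos s - 1\<close> lies between \<open>- 2\<close> and \<open>0\<close>\<close>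
  also have "\<dots> \<le> exp 2 * (s\<^sup>2 * (s\<^sup>2 + \<tau>\<^sup>2))"
  proof (intro mult_mono)
    show "exp \<bar>Re (z - 1)\<bar> \<le> exp 2"
      using cos_ge_minus_one[of s] Re by (simp add: z_def)
    have c: "\<bar>cos s - 1\<bar> \<le> s\<^sup>2"
    proof -
      define r where "r = (sin (s/2))\<^sup>2"
      have "cos s = 1 - 2 * r"
        using cos_double_sin[of "s/2"] by (simp add: r_def)
      moreover have "r \<le> (s/2)\<^sup>2"
        using abs_sin_x_le_abs_x[of "s/2"] unfolding r_def by (simp only: abs_le_square_iff)
      then have "4 * r \<le> s\<^sup>2" by (simp add: power_divide)
      moreover have "0 \<le> r" by (simp add: r_def)
      ultimately show ?thesis by (simp add: abs_if)
    qed
    have "(cos s - 1)\<^sup>2 \<le> (s\<^sup>2)\<^sup>2"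
      by (rule iffD1[OF abs_le_square_iff]) (use c in simp)
    moreover have "(\<tau> * sin s)\<^sup>2 \<le> \<tau>\<^sup>2 * s\<^sup>2"
      using abs_sin_x_le_abs_x[of s]
      by (simp add: power_mult_distrib mult_left_mono abs_le_square_iff)
    moreover have "norm (z - 1) ^ 2 = (cos s - 1)\<^sup>2 + (\<tau> * sin s)\<^sup>2"
      by (simp add: cmod_power2 z_def)
    ultimately show "norm (z - 1) ^ 2 \<le> s\<^sup>2 * (s\<^sup>2 + \<tau>\<^sup>2)"
      by (simp add: distrib_left power2_eq_square[of "s\<^sup>2"] mult.commute)
  qed auto
  finally have diff: "norm (z - exp (z - 1)) \<le> exp 2 * (s\<^sup>2 * (s\<^sup>2 + \<tau>\<^sup>2))" .
  have "exp (z - 1) ^ n = exp (of_nat n * (z - 1))"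
    by (simp add: exp_of_nat_mult)
  also have "of_nat n * (z - 1) = complex_of_real (real n * (cos s - 1)) + \<i> * complex_of_real (real n * \<tau> * sin s)"
    by (simp add: complex_eq_iff z_def)
  also have "exp \<dots> = exp (complex_of_real (real n * (cos s - 1))) * cis (real n * \<tau> * sin s)"
    by (simp only: exp_add cis_conv_exp)
  finally have power: "exp (z - 1) ^ n = exp (complex_of_real (real n * (cos s - 1))) * cis (real n * \<tau> * sin s)" .
  have "norm (z ^ n - exp (z - 1) ^ n) \<le> real n * norm (z - exp (z - 1))"
    using z1 \<open>norm (exp (z - 1)) \<le> 1\<close> by (rule norm_power_diff)
  also have "\<dots> \<le> real n * (exp 2 * (s\<^sup>2 * (s\<^sup>2 + \<tau>\<^sup>2)))"
    using diff by (rule mult_left_mono) simp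
  finally show ?thesis
    unfolding power by (simp add: z_def mult_ac)
qed

lemma abs_tanh_le_1: "\<bar>tanh (x :: real)\<bar> \<le> 1"
  using tanh_real_bounds[of x] by (simp add: abs_le_iff)

lemma borel_measurable_tilted_spin_char_power:
  fixes b s :: real
  shows "(\<lambda>x. Complex (cos s) (tanh (b * x) * sin s) ^ n) \<in> borel_measurable borel"
proof -
  have "Complex (cos s) (tanh (b * x) * sin s) = of_real (cos s) + \<i> * of_real (tanh (b * x) * sin s)" for x
    by (simp add: complex_eq_iff)
  then show ?thesis
    by (simp only:) (intro borel_measurable_continuous_onI continuous_intros, auto)
qed

lemma norm_tilted_spin_char_power_le_1:
  fixes x s :: real
  shows "norm (Complex (cos s) (tanh x * sin s) ^ n) \<le> 1"
  unfolding norm_power by (intro power_le_one norm_tilted_spin_char_le_1 abs_tanh_le_1) simp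

section \<open>Linearising the Gibbs weight by a Gaussian field\<close>

lemma gaussian_laplace_transform:
  fixes c \<kappa> :: real
  assumes "0 < \<kappa>"
  shows "integrable lborel (\<lambda>x. exp (c * x - \<kappa> * x\<^sup>2))"
    and "(\<integral>x. exp (c * x - \<kappa> * x\<^sup>2) \<partial>lborel) = sqrt (pi / \<kappa>) * exp (c\<^sup>2 / (4 * \<kappa>))"
proof -
  let ?C = "sqrt (pi / \<kappa>) * exp (c\<^sup>2 / (4 * \<kappa>))"
  define \<sigma> where "\<sigma> = sqrt (1 / (2 * \<kappa>))"
  have \<sigma>: "0 < \<sigma>" "\<sigma>\<^sup>2 = 1 / (2 * \<kappa>)" using assms by (auto simp: \<sigma>_def)
  have *: "exp (c * x - \<kappa> * x\<^sup>2) = ?C * normal_density (c / (2 * \<kappa>)) \<sigma> x" for x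
  proof -
    have "c * x - \<kappa> * x\<^sup>2 = c\<^sup>2 / (4 * \<kappa>) + - (x - c / (2 * \<kappa>))\<^sup>2 / (2 * \<sigma>\<^sup>2)"
      unfolding \<sigma>(2) using assms by (simp add: power2_eq_square field_simps)
    moreover have "sqrt (pi / \<kappa>) * (1 / sqrt (2 * pi * \<sigma>\<^sup>2)) = 1"
      using assms by (simp add: \<sigma>)
    moreover have "?C * normal_density (c / (2 * \<kappa>)) \<sigma> x = (sqrt (pi / \<kappa>) * (1 / sqrt (2 * pi * \<sigma>\<^sup>2)))
        * (exp (c\<^sup>2 / (4 * \<kappa>)) * exp (- (x - c / (2 * \<kappa>))\<^sup>2 / (2 * \<sigma>\<^sup>2)))"
      by (simp only: normal_density_def mult_ac)
    ultimately show ?thesis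
      by (simp only: exp_add mult_1_left)
  qed
  show "integrable lborel (\<lambda>x. exp (c * x - \<kappa> * x\<^sup>2))"
    unfolding * using \<sigma>(1) by simp
  show "(\<integral>x. exp (c * x - \<kappa> * x\<^sup>2) \<partial>lborel) = ?C"
    unfolding * using \<sigma>(1) by simp
qed

lemma integral_uniform_sign:
  fixes f :: "real \<Rightarrow> 'b :: {banach, second_countable_topology}"
  assumes [measurable]: "f \<in> borel_measurable borel"
  shows "(\<integral>x. f x \<partial>uniform_sign) = (1 / 2) *\<^sub>R (f 1 + f (-1))"
proof -
  have "(\<integral>x. f x \<partial>uniform_sign) = (\<integral>x. f x \<partial>measure_pmf (pmf_of_set {-1, 1 :: real}))"
    unfolding uniform_sign_def by (subst integral_distr) auto
  also have "\<dots> = (\<Sum>a\<in>{-1, 1}. pmf (pmf_of_set {-1, 1}) a *\<^sub>R f a)"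
    by (rule integral_measure_pmf) auto
  also have "\<dots> = (1 / 2) *\<^sub>R (f 1 + f (-1))"
    by (simp add: scaleR_add_right add.commute)
  finally show ?thesis .
qed

lemma sets_uniform_sign [measurable_cong, simp]: "sets uniform_sign = sets borel"
  by (simp add: uniform_sign_def)

lemma AE_uniform_sign: "AE x in uniform_sign. \<bar>x\<bar> = 1"
  unfolding uniform_sign_def by (subst AE_distr_iff) (auto simp: AE_measure_pmf_iff)

lemma integral_exp_magnetisation:
  fixes z :: complex
  shows "(\<integral>y. exp (z * of_real (magnetisation n y)) \<partial>free_spins n) = cosh z ^ n"
proof -
  interpret prob_space uniform_sign by (rule prob_space_uniform_sign)
  interpret product_sigma_finite "\<lambda>_::nat. uniform_sign" by unfold_locales
  have "(\<integral>y. exp (z * of_real (magnetisation n y)) \<partial>free_spins n)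
      = (\<integral>y. (\<Prod>k\<in>{1..n}. exp (z * of_real (y k))) \<partial>Pi\<^sub>M {1..n} (\<lambda>_. uniform_sign))"
    unfolding free_spins_def magnetisation_def by (simp add: sum_distrib_left exp_sum)
  also have "\<dots> = (\<Prod>k\<in>{1..n}. (\<integral>x. exp (z * of_real x) \<partial>uniform_sign))"
  proof (rule product_integral_prod)
    show "integrable uniform_sign (\<lambda>x. exp (z * of_real x))"
    proof (rule integrable_const_bound)
      show "AE x in uniform_sign. norm (exp (z * complex_of_real x)) \<le> exp (norm z)"
        using AE_uniform_sign
      proof eventually_elim
        case (elim x)
        have "norm (exp (z * complex_of_real x)) \<le> exp (norm (z * complex_of_real x))"
          by (rule norm_exp)
        then show ?case using elim by (simp add: norm_mult)
      qed
    qed measurable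
  qed simp
  also have "(\<integral>x. exp (z * of_real x) \<partial>uniform_sign) = cosh z"
    by (subst integral_uniform_sign) (auto simp: cosh_def)
  finally show ?thesis by simp
qed

lemma cosh_shift_imaginary:
  fixes u s :: real
  shows "cosh (of_real u + \<i> * of_real s) = of_real (cosh u) * Complex (cos s) (tanh u * sin s)"
proof -
  have "sinh u = cosh u * tanh u"
    by (simp add: tanh_def)
  moreover have "Re (cosh (of_real u + \<i> * of_real s)) = cosh u * cos s"
    by (simp add: cosh_field_def Re_exp field_simps)
  moreover have "Im (cosh (of_real u + \<i> * of_real s)) = sinh u * sin s"
    by (simp add: cosh_field_def sinh_field_def Im_exp field_simps)
  ultimately show ?thesis
    by (simp add: complex_eq_iff)
qed

text \<open>
  Both sides are iterated integrals of \<open>exp ((b x + \<i> s) M - \<kappa> x\<^sup>2)\<close> over the spins and the auxiliary field \<open>x\<close>.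
  Integrating out \<open>x\<close> restores the Gibbs weight, because \<open>b\<^sup>2 / (4 \<kappa>) = \<beta> / (2 n)\<close>; integrating out the
  independent spins first gives the \<open>n\<close>-th power of \<open>cosh (b x + \<i> s)\<close>. Only \<open>b\<^sup>2 / \<kappa>\<close> is determined
  by \<open>\<beta>\<close> and \<open>n\<close>: the scale of \<open>x\<close> is free, and each regime picks the one in which the field has a limit.
\<close>
lemma hubbard_stratonovich:
  fixes b \<kappa> \<beta> s :: real
  assumes n: "0 < n" and \<kappa>: "0 < \<kappa>" and b: "real n * b\<^sup>2 = 2 * \<beta> * \<kappa>"
  shows "(\<integral>y. iexp (s * magnetisation n y) * of_real (gibbs_weight n \<beta> y) \<partial>free_spins n)
      = of_real (1 / sqrt (pi / \<kappa>)) *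
        (\<integral>x. Complex (cos s) (tanh (b * x) * sin s) ^ n * of_real (cosh (b * x) ^ n * exp (- \<kappa> * x\<^sup>2)) \<partial>lborel)"
    and "integrable lborel (\<lambda>x. cosh (b * x) ^ n * exp (- \<kappa> * x\<^sup>2))"
proof -
  interpret prob_space "free_spins n" by (rule prob_space_free_spins)
  interpret pair_sigma_finite "free_spins n" lborel by unfold_locales
  note [measurable] = measurable_magnetisation
  let ?M = "magnetisation n"
  define f where "f s y x = exp ((of_real (b * x) + \<i> * of_real s) * of_real (?M y)) * of_real (exp (- \<kappa> * x\<^sup>2))"
    for s y and x :: real
  have norm_f: "norm (f s y x) = exp (b * ?M y * x - \<kappa> * x\<^sup>2)" for s x y
  proof -
    have "norm (f s y x) = exp (b * x * ?M y) * exp (- \<kappa> * x\<^sup>2)"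
      by (simp add: f_def norm_mult)
    then show ?thesis by (simp add: exp_add[symmetric] mult_ac)
  qed
  have "b\<^sup>2 = 2 * \<beta> * \<kappa> / real n" using b n by (simp add: field_simps)
  then have gibbs: "(\<integral>x. exp (b * ?M y * x - \<kappa> * x\<^sup>2) \<partial>lborel) = sqrt (pi / \<kappa>) * gibbs_weight n \<beta> y" for y
    using \<kappa> by (simp add: gaussian_laplace_transform gibbs_weight_def power_mult_distrib)
  have int_f: "integrable lborel (f s y)" for s y
  proof (rule Bochner_Integration.integrable_bound[OF gaussian_laplace_transform(1)[OF \<kappa>, of "b * ?M y"]])
    show "f s y \<in> borel_measurable lborel"
      unfolding f_def[abs_def] by measurable
  qed (simp add: norm_f)
  have pair: "integrable (free_spins n \<Otimes>\<^sub>M lborel) (case_prod (f s))" for s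
  proof (rule Fubini_integrable)
    show "case_prod (f s) \<in> borel_measurable (free_spins n \<Otimes>\<^sub>M lborel)"
      unfolding f_def[abs_def] by measurable
    show "integrable (free_spins n) (\<lambda>x. \<integral>y. norm (case_prod (f s) (x, y)) \<partial>lborel)"
      by (simp add: norm_f gibbs integrable_gibbs_weight)
  qed (simp add: int_f)
  have in_x: "(\<integral>y. f s y x \<partial>free_spins n)
      = Complex (cos s) (tanh (b * x) * sin s) ^ n * of_real (cosh (b * x) ^ n * exp (- \<kappa> * x\<^sup>2))" for s x
    unfolding f_def by (simp add: integral_exp_magnetisation cosh_shift_imaginary power_mult_distrib del: of_real_mult)
      (simp add: mult_ac)
  have in_y: "(\<integral>x. f s y x \<partial>lborel) = of_real (sqrt (pi / \<kappa>)) * (iexp (s * ?M y) * of_real (gibbs_weight n \<beta> y))" for s y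
  proof -
    have "f s y x = iexp (s * ?M y) * of_real (exp (b * ?M y * x - \<kappa> * x\<^sup>2))" for x
      unfolding f_def exp_of_real[symmetric] exp_add[symmetric] by (simp add: algebra_simps)
    then have "(\<integral>x. f s y x \<partial>lborel) = iexp (s * ?M y) * of_real (\<integral>x. exp (b * ?M y * x - \<kappa> * x\<^sup>2) \<partial>lborel)"
      by simp
    then show ?thesis by (simp add: gibbs)
  qed
  from Fubini_integral[OF pair, of s] \<kappa>
  show "(\<integral>y. iexp (s * ?M y) * of_real (gibbs_weight n \<beta> y) \<partial>free_spins n)
      = of_real (1 / sqrt (pi / \<kappa>)) *
        (\<integral>x. Complex (cos s) (tanh (b * x) * sin s) ^ n * of_real (cosh (b * x) ^ n * exp (- \<kappa> * x\<^sup>2)) \<partial>lborel)"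
    unfolding in_x in_y integral_mult_right_zero by (simp add: nonzero_eq_divide_eq)
  have "integrable lborel (\<lambda>x. \<integral>y. f 0 y x \<partial>free_spins n)"
    using integrable_snd[OF pair[of 0]] by simp
  then have "integrable lborel (\<lambda>x. of_real (cosh (b * x) ^ n * exp (- \<kappa> * x\<^sup>2)) :: complex)"
    unfolding in_x by (simp add: complex_eq_iff one_complex.code[symmetric])
  then show "integrable lborel (\<lambda>x. cosh (b * x) ^ n * exp (- \<kappa> * x\<^sup>2))"
    by (simp only: complex_of_real_integrable_eq)
qed

text \<open>
  The constant \<open>1 / sqrt (pi / \<kappa>)\<close> cancels against the partition function, which is the case \<open>s = 0\<close> of the same formula.
\<close>
lemma char_curie_weiss:
  fixes b \<kappa> \<beta> a t :: real
  assumes n: "0 < n" and \<kappa>: "0 < \<kappa>" and b: "real n * b\<^sup>2 = 2 * \<beta> * \<kappa>"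
  defines "w \<equiv> \<lambda>x. cosh (b * x) ^ n * exp (- \<kappa> * x\<^sup>2)"
  shows "char (distr (curie_weiss n \<beta>) borel (\<lambda>x. magnetisation n x / a)) t
      = (\<integral>x. Complex (cos (t / a)) (tanh (b * x) * sin (t / a)) ^ n * of_real (w x) \<partial>lborel)
        / of_real (\<integral>x. w x \<partial>lborel)"
proof -
  note [measurable] = measurable_magnetisation
  note hs = hubbard_stratonovich(1)[OF n \<kappa> b]
  let ?Z = "\<integral>y. gibbs_weight n \<beta> y \<partial>free_spins n"
  have [measurable]: "gibbs_weight n \<beta> \<in> borel_measurable (free_spins n)"
    unfolding gibbs_weight_def[abs_def] by measurable
  have Z: "of_real ?Z = of_real (1 / sqrt (pi / \<kappa>)) * (of_real (\<integral>x. w x \<partial>lborel) :: complex)"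
    using hs[of 0] by (simp add: w_def one_complex.code[symmetric] del: of_real_mult of_real_power)
  have "0 \<le> ?Z"
    by (rule Bochner_Integration.integral_nonneg) (simp add: gibbs_weight_def)
  have "char (distr (curie_weiss n \<beta>) borel (\<lambda>x. magnetisation n x / a)) t
      = (\<integral>y. iexp (t * (magnetisation n y / a)) \<partial>curie_weiss n \<beta>)"
    unfolding char_def by (subst integral_distr) (auto simp: curie_weiss_def)
  also have "\<dots> = (\<integral>y. (gibbs_weight n \<beta> y / ?Z) *\<^sub>R iexp (t * (magnetisation n y / a)) \<partial>free_spins n)"
    unfolding curie_weiss_def using \<open>0 \<le> ?Z\<close>
    by (subst integral_density) (auto simp: gibbs_weight_def)
  also have "\<dots> = (\<integral>y. iexp ((t / a) * magnetisation n y) * of_real (gibbs_weight n \<beta> y) / of_real ?Z \<partial>free_spins n)"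
    by (simp add: scaleR_conv_of_real mult_ac)
  also have "\<dots> = (\<integral>y. iexp ((t / a) * magnetisation n y) * of_real (gibbs_weight n \<beta> y) \<partial>free_spins n) / of_real ?Z"
    by (rule integral_divide_zero)
  also have "\<dots> = (\<integral>x. Complex (cos (t / a)) (tanh (b * x) * sin (t / a)) ^ n * of_real (w x) \<partial>lborel)
        / of_real (\<integral>x. w x \<partial>lborel)"
    unfolding hs Z using \<kappa> by (simp add: w_def)
  finally show ?thesis .
qed

section \<open>Limits of the characteristic functions\<close>

lemma dominated_convergence_eventually:
  fixes s :: "nat \<Rightarrow> 'a \<Rightarrow> 'b::{banach, second_countable_topology}" and w :: "'a \<Rightarrow> real"
  assumes "f \<in> borel_measurable M" "\<And>n. s n \<in> borel_measurable M" "integrable M w"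
    and lim: "\<And>x. (\<lambda>n. s n x) \<longlonglongrightarrow> f x"
    and bound: "\<forall>\<^sub>F n in sequentially. \<forall>x. norm (s n x) \<le> w x"
  shows "(\<lambda>n. integral\<^sup>L M (s n)) \<longlonglongrightarrow> integral\<^sup>L M f"
proof -
  from bound obtain N where N: "\<And>n x. N \<le> n \<Longrightarrow> norm (s n x) \<le> w x"
    by (auto simp: eventually_sequentially)
  show ?thesis
  proof (rule LIMSEQ_offset[where k = N], rule integral_dominated_convergence[where w = w])
    show "AE x in M. (\<lambda>n. s (n + N) x) \<longlonglongrightarrow> f x"
      using lim by (intro AE_I2 LIMSEQ_ignore_initial_segment)
    show "AE x in M. norm (s (n + N) x) \<le> w x" for n
      using N by simp
  qed (use assms in auto)
qed

text \<open>
  The two factors of the limit separate the sources of randomness: \<open>exp (- A / 2)\<close> comes from the fluctuations of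
  the spins around their mean, and \<open>cis (m * x)\<close> from the mean itself.
\<close>
lemma tendsto_tilted_spin_char_power:
  fixes s b :: "nat \<Rightarrow> real"
  assumes s: "s \<longlonglongrightarrow> 0" and b: "b \<longlonglongrightarrow> 0"
    and A: "(\<lambda>n. real n * (s n)\<^sup>2) \<longlonglongrightarrow> A"
    and m: "(\<lambda>n. real n * s n * b n) \<longlonglongrightarrow> m"
  shows "(\<lambda>n. Complex (cos (s n)) (tanh (b n * x) * sin (s n)) ^ n)
          \<longlonglongrightarrow> exp (complex_of_real (- A / 2)) * cis (m * x)"
proof -
  define \<tau> where "\<tau> n = tanh (b n * x)" for n
  have bx: "(\<lambda>n. b n * x) \<longlonglongrightarrow> 0"
    using tendsto_mult[OF b tendsto_const[of x]] by simp
  have \<tau>: "\<tau> \<longlonglongrightarrow> 0"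
    using tendsto_tanh[OF bx] by (simp add: \<tau>_def[abs_def])
  have \<tau>1: "\<bar>\<tau> n\<bar> \<le> 1" for n
    unfolding \<tau>_def by (rule abs_tanh_le_1)
  have "(\<lambda>n. real n * (cos (s n) - 1)) \<longlonglongrightarrow> A * (- 1 / 2)"
    by (rule tendsto_scaled[OF tendsto_cos_quadratic _ _ s A]) auto
  then have c: "(\<lambda>n. real n * (cos (s n) - 1)) \<longlonglongrightarrow> - A / 2"
    by simp
  have "(\<lambda>n. real n * s n * tanh (b n * x)) \<longlonglongrightarrow> (m * x) * 1"
    by (rule tendsto_scaled[OF tendsto_tanh_linear _ _ bx])
       (use tendsto_mult[OF m tendsto_const[of x]] in \<open>auto simp: mult.assoc\<close>)
  then have "(\<lambda>n. real n * \<tau> n * s n ^ 1) \<longlonglongrightarrow> m * x"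
    by (simp add: \<tau>_def mult_ac)
  then have "(\<lambda>n. real n * \<tau> n * sin (s n)) \<longlonglongrightarrow> (m * x) * 1"
    by (intro tendsto_scaled[OF tendsto_sin_linear _ _ s]) auto
  then have d: "(\<lambda>n. real n * \<tau> n * sin (s n)) \<longlonglongrightarrow> m * x"
    by simp
  have main: "(\<lambda>n. exp (complex_of_real (real n * (cos (s n) - 1))) * cis (real n * \<tau> n * sin (s n)))
          \<longlonglongrightarrow> exp (complex_of_real (- A / 2)) * cis (m * x)"
    unfolding cis_conv_exp
    by (intro tendsto_mult[OF tendsto_exp[OF tendsto_of_real[OF c]]]
      tendsto_exp tendsto_mult[OF tendsto_const tendsto_of_real[OF d]])
  have "(\<lambda>n. real n * (s n)\<^sup>2 * ((s n)\<^sup>2 + (\<tau> n)\<^sup>2) * exp 2) \<longlonglongrightarrow> A * (0\<^sup>2 + 0\<^sup>2) * exp 2"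
    using A s \<tau> by (intro tendsto_intros)
  then have "(\<lambda>n. real n * ((s n)\<^sup>2 * ((s n)\<^sup>2 + (\<tau> n)\<^sup>2) * exp 2)) \<longlonglongrightarrow> 0"
    by (simp add: mult.assoc)
  then have "(\<lambda>n. Complex (cos (s n)) (\<tau> n * sin (s n)) ^ n
      - exp (complex_of_real (real n * (cos (s n) - 1))) * cis (real n * \<tau> n * sin (s n))) \<longlonglongrightarrow> 0"
    by (rule Lim_null_comparison[rotated]) (intro always_eventually allI tilted_spin_char_power \<tau>1)
  from tendsto_add[OF this main] show ?thesis
    by (simp add: \<tau>_def)
qed

text \<open>
  Dominated convergence in numerator and denominator of \<open>char_curie_weiss\<close>. The limit is the characteristic function
  at \<open>t\<close> of \<open>sqrt A\<close> times a standard normal variable plus \<open>m\<close> times an independent variable with density proportional to \<open>w\<close>.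
\<close>
lemma char_curie_weiss_tendsto:
  fixes \<beta> a b \<kappa> :: "nat \<Rightarrow> real" and w W :: "real \<Rightarrow> real"
  assumes \<kappa>: "\<forall>\<^sub>F n in sequentially. 0 < \<kappa> n \<and> real n * (b n)\<^sup>2 = 2 * \<beta> n * \<kappa> n"
    and b: "b \<longlonglongrightarrow> 0" and a: "(\<lambda>n. 1 / a n) \<longlonglongrightarrow> 0"
    and A: "(\<lambda>n. real n / (a n)\<^sup>2) \<longlonglongrightarrow> A" and m: "(\<lambda>n. real n * b n / a n) \<longlonglongrightarrow> m"
    and w: "\<And>x. (\<lambda>n. cosh (b n * x) ^ n * exp (- \<kappa> n * x\<^sup>2)) \<longlonglongrightarrow> w x"
    and W: "\<forall>\<^sub>F n in sequentially. \<forall>x. cosh (b n * x) ^ n * exp (- \<kappa> n * x\<^sup>2) \<le> W x"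
    and [measurable]: "w \<in> borel_measurable borel"
    and "integrable lborel W" and nz: "(\<integral>x. w x \<partial>lborel) \<noteq> 0"
  shows "(\<lambda>n. char (distr (curie_weiss n (\<beta> n)) borel (\<lambda>x. magnetisation n x / a n)) t)
      \<longlonglongrightarrow> exp (complex_of_real (- (A * t\<^sup>2) / 2)) * ((\<integral>x. cis (m * t * x) * of_real (w x) \<partial>lborel) / of_real (\<integral>x. w x \<partial>lborel))"
proof -
  define wn where "wn n x = cosh (b n * x) ^ n * exp (- \<kappa> n * x\<^sup>2)" for n and x :: real
  define \<phi> where "\<phi> n x = Complex (cos (t / a n)) (tanh (b n * x) * sin (t / a n)) ^ n" for n and x :: real
  have wn_nonneg: "0 \<le> wn n x" for n x by (simp add: wn_def)
  have [measurable]: "wn n \<in> borel_measurable borel" for n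
    unfolding wn_def[abs_def]
    by (intro borel_measurable_continuous_onI continuous_intros)
  have [measurable]: "\<phi> n \<in> borel_measurable borel" for n
    unfolding \<phi>_def[abs_def] by (rule borel_measurable_tilted_spin_char_power)
  have \<phi>1: "norm (\<phi> n x) \<le> 1" for n x
    unfolding \<phi>_def by (rule norm_tilted_spin_char_power_le_1)
  have s: "(\<lambda>n. t / a n) \<longlonglongrightarrow> 0"
    using tendsto_mult[OF tendsto_const[of t] a] by simp
  have \<phi>_lim: "(\<lambda>n. \<phi> n x) \<longlonglongrightarrow> exp (complex_of_real (- (A * t\<^sup>2) / 2)) * cis (m * t * x)" for x
    unfolding \<phi>_def
  proof (rule tendsto_tilted_spin_char_power[OF s b])
    show "(\<lambda>n. real n * (t / a n)\<^sup>2) \<longlonglongrightarrow> A * t\<^sup>2"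
      using tendsto_mult[OF A tendsto_const[of "t\<^sup>2"]] by (simp add: power_divide)
    show "(\<lambda>n. real n * (t / a n) * b n) \<longlonglongrightarrow> m * t"
      using tendsto_mult[OF m tendsto_const[of t]] by (simp add: mult_ac)
  qed
  have lim_w: "(\<lambda>n. \<integral>x. wn n x \<partial>lborel) \<longlonglongrightarrow> (\<integral>x. w x \<partial>lborel)"
  proof (rule dominated_convergence_eventually[where w = W])
    show "\<forall>\<^sub>F n in sequentially. \<forall>x. norm (wn n x) \<le> W x"
      using W wn_nonneg by (simp add: wn_def)
    show "(\<lambda>n. wn n x) \<longlonglongrightarrow> w x" for x
      using w[of x] by (simp only: wn_def)
  qed (use \<open>integrable lborel W\<close> in simp_all)
  have lim_\<phi>w: "(\<lambda>n. \<integral>x. \<phi> n x * of_real (wn n x) \<partial>lborel)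
      \<longlonglongrightarrow> (\<integral>x. exp (complex_of_real (- (A * t\<^sup>2) / 2)) * cis (m * t * x) * of_real (w x) \<partial>lborel)"
  proof (rule dominated_convergence_eventually[where w = W])
    show "(\<lambda>x. exp (complex_of_real (- (A * t\<^sup>2) / 2)) * cis (m * t * x) * of_real (w x)) \<in> borel_measurable lborel"
      unfolding cis_conv_exp by measurable
    show "(\<lambda>x. \<phi> n x * of_real (wn n x)) \<in> borel_measurable lborel" for n
      by measurable
    show "(\<lambda>n. \<phi> n x * of_real (wn n x)) \<longlonglongrightarrow> exp (complex_of_real (- (A * t\<^sup>2) / 2)) * cis (m * t * x) * of_real (w x)" for x
      using w[of x] by (intro tendsto_mult \<phi>_lim tendsto_of_real) (simp add: wn_def)
    show "\<forall>\<^sub>F n in sequentially. \<forall>x. norm (\<phi> n x * of_real (wn n x)) \<le> W x"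
      using W
    proof eventually_elim
      case (elim n)
      show ?case
      proof
        fix x
        have "norm (\<phi> n x * of_real (wn n x)) \<le> 1 * wn n x"
          unfolding norm_mult using \<phi>1 wn_nonneg by (intro mult_mono) auto
        also have "\<dots> \<le> W x" using elim by (simp add: wn_def)
        finally show "norm (\<phi> n x * of_real (wn n x)) \<le> W x" .
      qed
    qed
  qed fact
  have "(\<lambda>n. (\<integral>x. \<phi> n x * of_real (wn n x) \<partial>lborel) / of_real (\<integral>x. wn n x \<partial>lborel))
      \<longlonglongrightarrow> (\<integral>x. exp (complex_of_real (- (A * t\<^sup>2) / 2)) * cis (m * t * x) * of_real (w x) \<partial>lborel) / of_real (\<integral>x. w x \<partial>lborel)"
    using lim_\<phi>w lim_w nz by (intro tendsto_divide tendsto_of_real) auto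
  also have "(\<integral>x. exp (complex_of_real (- (A * t\<^sup>2) / 2)) * cis (m * t * x) * of_real (w x) \<partial>lborel)
      = exp (complex_of_real (- (A * t\<^sup>2) / 2)) * (\<integral>x. cis (m * t * x) * of_real (w x) \<partial>lborel)"
    unfolding mult.assoc by (rule integral_mult_right_zero)
  finally have main: "(\<lambda>n. (\<integral>x. \<phi> n x * of_real (wn n x) \<partial>lborel) / of_real (\<integral>x. wn n x \<partial>lborel))
      \<longlonglongrightarrow> exp (complex_of_real (- (A * t\<^sup>2) / 2)) * ((\<integral>x. cis (m * t * x) * of_real (w x) \<partial>lborel) / of_real (\<integral>x. w x \<partial>lborel))"
    by simp
  show ?thesis
  proof (rule Lim_transform_eventually[OF main])
    show "\<forall>\<^sub>F n in sequentially. (\<integral>x. \<phi> n x * of_real (wn n x) \<partial>lborel) / of_real (\<integral>x. wn n x \<partial>lborel)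
      = char (distr (curie_weiss n (\<beta> n)) borel (\<lambda>x. magnetisation n x / a n)) t"
      using \<kappa> eventually_gt_at_top[of 0]
    proof eventually_elim
      case (elim n)
      then show ?case
        using char_curie_weiss[of n "\<kappa> n" "b n" "\<beta> n" "a n" t]
        by (simp add: \<phi>_def wn_def)
    qed
  qed
qed

lemma fourier_gaussian:
  fixes c s :: real
  assumes "0 < c"
  shows "(\<integral>x. cis (s * x) * of_real (exp (- c * x\<^sup>2 / 2)) \<partial>lborel)
      = of_real (sqrt (2 * pi / c) * exp (- s\<^sup>2 / (2 * c)))"
proof -
  define r where "r = 1 / sqrt c"
  have r: "0 < r" "r\<^sup>2 = 1 / c" using assms by (auto simp: r_def power_divide)
  have "of_real (exp (- (s * r)\<^sup>2 / 2)) = char std_normal_distribution (s * r)"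
    by (simp add: char_std_normal_distribution)
  also have "\<dots> = (\<integral>y. std_normal_density y *\<^sub>R iexp (s * r * y) \<partial>lborel)"
    unfolding char_def by (subst integral_density) auto
  also have "\<dots> = (\<integral>y. of_real (1 / sqrt (2 * pi)) * (cis (s * (r * y)) * of_real (exp (- c * (r * y)\<^sup>2 / 2))) \<partial>lborel)"
    using assms by (intro Bochner_Integration.integral_cong)
      (auto simp: std_normal_density_def scaleR_conv_of_real cis_conv_exp power_mult_distrib r(2) mult_ac)
  also have "\<dots> = of_real (1 / sqrt (2 * pi)) * (\<integral>y. cis (s * (r * y)) * of_real (exp (- c * (r * y)\<^sup>2 / 2)) \<partial>lborel)"
    by (rule integral_mult_right_zero)
  finally have *: "(\<integral>y. cis (s * (r * y)) * of_real (exp (- c * (r * y)\<^sup>2 / 2)) \<partial>lborel)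
      = of_real (sqrt (2 * pi) * exp (- (s * r)\<^sup>2 / 2))"
    by (simp add: field_simps)
  have "(\<integral>x. cis (s * x) * of_real (exp (- c * x\<^sup>2 / 2)) \<partial>lborel)
      = \<bar>r\<bar> *\<^sub>R (\<integral>y. cis (s * (0 + r * y)) * of_real (exp (- c * (0 + r * y)\<^sup>2 / 2)) \<partial>lborel)"
    using r by (intro lborel_integral_real_affine) auto
  also have "\<dots> = of_real (r * (sqrt (2 * pi) * exp (- (s * r)\<^sup>2 / 2)))"
    using * r(1) by (simp add: scaleR_conv_of_real)
  also have "r * (sqrt (2 * pi) * exp (- (s * r)\<^sup>2 / 2)) = sqrt (2 * pi / c) * exp (- s\<^sup>2 / (2 * c))"
    using assms by (simp add: power_mult_distrib r(2)) (simp add: r_def real_sqrt_divide)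
  finally show ?thesis .
qed

lemma char_density_lborel:
  assumes [measurable]: "f \<in> borel_measurable borel" and "\<And>x. 0 \<le> f x"
  shows "char (density lborel (\<lambda>x. ennreal (f x))) t = (\<integral>x. cis (t * x) * of_real (f x) \<partial>lborel)"
  unfolding char_def using assms(2)
  by (subst integral_density) (auto simp: scaleR_conv_of_real cis_conv_exp mult.commute)

lemma char_normal:
  fixes c :: real
  assumes "0 < c"
  shows "char (density lborel (\<lambda>x. ennreal (normal_density 0 (sqrt (1 / c)) x))) t = of_real (exp (- t\<^sup>2 / (2 * c)))"
proof -
  have "char (density lborel (\<lambda>x. ennreal (normal_density 0 (sqrt (1 / c)) x))) t
      = (\<integral>x. of_real (1 / sqrt (2 * pi / c)) * (cis (t * x) * of_real (exp (- c * x\<^sup>2 / 2))) \<partial>lborel)"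
    using assms by (subst char_density_lborel)
      (auto simp: normal_density_def mult_ac intro!: Bochner_Integration.integral_cong)
  also have "\<dots> = of_real (1 / sqrt (2 * pi / c)) * (\<integral>x. cis (t * x) * of_real (exp (- c * x\<^sup>2 / 2)) \<partial>lborel)"
    by (rule integral_mult_right_zero)
  also have "\<dots> = of_real (exp (- t\<^sup>2 / (2 * c)))"
    using assms by (subst fourier_gaussian) auto
  finally show ?thesis .
qed

lemma char_normalised_law:
  assumes [measurable]: "f \<in> borel_measurable borel" and "\<And>x. 0 \<le> f x"
  shows "char (normalised_law f) t = (\<integral>x. cis (t * x) * of_real (f x) \<partial>lborel) / of_real (\<integral>x. f x \<partial>lborel)"
  unfolding normalised_law_def using assms(2)
  by (subst char_density_lborel) (auto intro!: divide_nonneg_nonneg Bochner_Integration.integral_nonneg)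

lemma weak_conv_curie_weiss:
  assumes "real_distribution \<mu>"
    and "\<And>t. (\<lambda>n. char (distr (curie_weiss n (\<beta> n)) borel (\<lambda>x. magnetisation n x / a n)) t) \<longlonglongrightarrow> char \<mu> t"
  shows "weak_conv_m (\<lambda>n. distr (curie_weiss n (\<beta> n)) borel (\<lambda>x. magnetisation n x / a n)) \<mu>"
proof (rule levy_continuity[OF _ assms])
  fix n
  interpret prob_space "curie_weiss n (\<beta> n)" by (rule prob_space_curie_weiss)
  have [measurable]: "magnetisation n \<in> borel_measurable (curie_weiss n (\<beta> n))"
    using measurable_magnetisation[of n] by (simp add: curie_weiss_def)
  show "real_distribution (distr (curie_weiss n (\<beta> n)) borel (\<lambda>x. magnetisation n x / a n))"
    by (rule real_distribution_distr) measurable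
qed

section \<open>High temperature and the critical window\<close>

text \<open>
  The quadratic part of \<open>n ln cosh (b x)\<close> is merged with the Gaussian \<open>\<kappa>\<close>: the two are both large near the critical point, and
  only their difference has a limit.
\<close>
lemma curie_weiss_weight_eq_exp:
  fixes b \<kappa> x :: real
  shows "cosh (b * x) ^ n * exp (- \<kappa> * x\<^sup>2)
      = exp (real n * (ln (cosh (b * x)) - (b * x)\<^sup>2 / 2) + (real n * b\<^sup>2 / 2 - \<kappa>) * x\<^sup>2)"
proof -
  have "cosh (b * x) ^ n = exp (real n * ln (cosh (b * x)))"
    by (simp add: exp_of_nat_mult)
  then show ?thesis
    by (simp add: exp_add[symmetric] algebra_simps power_mult_distrib)
qed

lemma tendsto_curie_weiss_weight:
  fixes b \<kappa> :: "nat \<Rightarrow> real"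
  assumes b: "b \<longlonglongrightarrow> 0" and q: "(\<lambda>n. real n * b n ^ 4) \<longlonglongrightarrow> q"
    and r: "(\<lambda>n. real n * (b n)\<^sup>2 / 2 - \<kappa> n) \<longlonglongrightarrow> r"
  shows "(\<lambda>n. cosh (b n * x) ^ n * exp (- \<kappa> n * x\<^sup>2)) \<longlonglongrightarrow> exp (r * x\<^sup>2 - q * x ^ 4 / 12)"
proof -
  have "(\<lambda>n. real n * (ln (cosh (b n * x)) - (b n * x)\<^sup>2 / 2)) \<longlonglongrightarrow> (q * x ^ 4) * (- 1 / 12)"
  proof (rule tendsto_scaled[OF tendsto_ln_cosh_quartic])
    show "(\<lambda>n. b n * x) \<longlonglongrightarrow> 0"
      using tendsto_mult[OF b tendsto_const[of x]] by simp
    show "(\<lambda>n. real n * (b n * x) ^ 4) \<longlonglongrightarrow> q * x ^ 4"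
      using tendsto_mult[OF q tendsto_const[of "x ^ 4"]] by (simp add: power_mult_distrib mult.assoc)
  qed auto
  from tendsto_exp[OF tendsto_add[OF this tendsto_mult[OF r tendsto_const[of "x\<^sup>2"]]]]
  show ?thesis
    unfolding curie_weiss_weight_eq_exp by (simp add: algebra_simps)
qed

lemma curie_weiss_weight_le:
  fixes b \<kappa> x :: real
  shows "cosh (b * x) ^ n * exp (- \<kappa> * x\<^sup>2)
      \<le> exp ((real n * b\<^sup>2 / 2 - \<kappa>) * x\<^sup>2 - real n * ((b * x) ^ 4 / (12 * (1 + (b * x)\<^sup>2))))"
  unfolding curie_weiss_weight_eq_exp
  using mult_left_mono[OF ln_cosh_upper[of "b * x"], of "real n"]
  by (simp add: right_diff_distrib)

text \<open>
  With \<open>b = sqrt (\<beta> / n)\<close> and \<open>\<kappa> = 1 / 2\<close> the field has limiting density proportional to \<open>exp (- (1 - \<beta>) x\<^sup>2 / 2)\<close>, which also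
  dominates since \<open>cosh u \<le> exp (u\<^sup>2 / 2)\<close>. This choice of \<open>b\<close> covers \<open>\<beta> = 0\<close>, where
  the field decouples from the spins.
\<close>
lemma weak_conv_subcritical:
  fixes \<beta> :: real
  assumes \<beta>: "0 \<le> \<beta>" "\<beta> < 1"
  shows "weak_conv_m
          (\<lambda>n. distr (curie_weiss n \<beta>) borel (\<lambda>x. magnetisation n x / sqrt (real n)))
          (density lborel (\<lambda>x. ennreal (normal_density 0 (sqrt (1 / (1 - \<beta>))) x)))"
proof (rule weak_conv_curie_weiss)
  interpret prob_space "density lborel (\<lambda>x. ennreal (normal_density 0 (sqrt (1 / (1 - \<beta>))) x))"
    using \<beta> by (intro prob_space_normal_density) auto
  show "real_distribution (density lborel (\<lambda>x. ennreal (normal_density 0 (sqrt (1 / (1 - \<beta>))) x)))"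
    by unfold_locales auto
next
  fix t :: real
  define w where "w x = exp (- (1 - \<beta>) * x\<^sup>2 / 2)" for x :: real
  have bn: "real n * (sqrt (\<beta> / real n))\<^sup>2 = \<beta>" if "0 < n" for n :: nat
    using that \<beta> by simp
  have w: "w = (\<lambda>x. exp (0 * x - (1 - \<beta>) / 2 * x\<^sup>2))"
    unfolding w_def[abs_def] by (intro ext arg_cong[where f = exp]) (simp add: field_simps)
  have w_int: "integrable lborel w" "(\<integral>x. w x \<partial>lborel) = sqrt (2 * pi / (1 - \<beta>))"
    using gaussian_laplace_transform[of "(1 - \<beta>) / 2" 0] \<beta> unfolding w by (simp_all add: mult.commute)
  have \<beta>n: "(\<lambda>n. \<beta> / real n) \<longlonglongrightarrow> 0"
    by (rule lim_const_over_n)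
  have b: "(\<lambda>n. sqrt (\<beta> / real n)) \<longlonglongrightarrow> 0"
    using tendsto_real_sqrt[OF \<beta>n] by simp
  have "(\<lambda>n. char (distr (curie_weiss n \<beta>) borel (\<lambda>x. magnetisation n x / sqrt (real n))) t)
      \<longlonglongrightarrow> exp (complex_of_real (- (1 * t\<^sup>2) / 2)) *
        ((\<integral>x. cis (sqrt \<beta> * t * x) * of_real (w x) \<partial>lborel) / of_real (\<integral>x. w x \<partial>lborel))"
  proof (rule char_curie_weiss_tendsto[where \<kappa> = "\<lambda>n. 1 / 2" and b = "\<lambda>n. sqrt (\<beta> / real n)" and W = w])
    show "\<forall>\<^sub>F n in sequentially. 0 < (1 / 2 :: real) \<and> real n * (sqrt (\<beta> / real n))\<^sup>2 = 2 * \<beta> * (1 / 2)"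
      using eventually_gt_at_top[of 0] by eventually_elim (simp add: bn del: real_sqrt_pow2_iff)
    show "(\<lambda>n. 1 / sqrt (real n)) \<longlonglongrightarrow> 0"
      by real_asymp
    show "(\<lambda>n. real n / (sqrt (real n))\<^sup>2) \<longlonglongrightarrow> 1"
      by (rule tendsto_eventually) (use eventually_gt_at_top[of 0] in eventually_elim, simp)
    show "(\<lambda>n. real n * sqrt (\<beta> / real n) / sqrt (real n)) \<longlonglongrightarrow> sqrt \<beta>"
      by (rule tendsto_eventually)
        (use eventually_gt_at_top[of 0] in eventually_elim, simp add: real_sqrt_divide field_simps)
    show "(\<lambda>n. cosh (sqrt (\<beta> / real n) * x) ^ n * exp (- (1 / 2) * x\<^sup>2)) \<longlonglongrightarrow> w x" for x
    proof -
      have "(\<lambda>n. real n * sqrt (\<beta> / real n) ^ 4) \<longlonglongrightarrow> 0"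
      proof (rule Lim_transform_eventually)
        show "(\<lambda>n. \<beta>\<^sup>2 / real n) \<longlonglongrightarrow> 0" by (rule lim_const_over_n)
        show "\<forall>\<^sub>F n in sequentially. \<beta>\<^sup>2 / real n = real n * sqrt (\<beta> / real n) ^ 4"
          using eventually_gt_at_top[of 0]
        proof eventually_elim
          case (elim n)
          have "sqrt (\<beta> / real n) ^ 4 = ((sqrt (\<beta> / real n))\<^sup>2)\<^sup>2" by simp
          also have "\<dots> = (\<beta> / real n)\<^sup>2" using \<beta> by simp
          finally show ?case using elim by (simp add: power2_eq_square)
        qed
      qed
      moreover have "(\<lambda>n. real n * (sqrt (\<beta> / real n))\<^sup>2 / 2 - 1 / 2) \<longlonglongrightarrow> (\<beta> - 1) / 2"
        by (rule tendsto_eventually)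
          (use eventually_gt_at_top[of 0] in eventually_elim, simp add: bn diff_divide_distrib del: real_sqrt_pow2_iff)
      ultimately have "(\<lambda>n. cosh (sqrt (\<beta> / real n) * x) ^ n * exp (- (1 / 2) * x\<^sup>2))
          \<longlonglongrightarrow> exp ((\<beta> - 1) / 2 * x\<^sup>2 - 0 * x ^ 4 / 12)"
        by (rule tendsto_curie_weiss_weight[OF b])
      moreover have "exp ((\<beta> - 1) / 2 * x\<^sup>2 - 0 * x ^ 4 / 12) = w x"
        by (simp add: w_def algebra_simps)
      ultimately show ?thesis by simp
    qed
    show "\<forall>\<^sub>F n in sequentially. \<forall>x. cosh (sqrt (\<beta> / real n) * x) ^ n * exp (- (1 / 2) * x\<^sup>2) \<le> w x"
      using eventually_gt_at_top[of 0]
    proof eventually_elim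
      case (elim n)
      show ?case
      proof
        fix x :: real
        let ?b = "sqrt (\<beta> / real n)"
        have "cosh (?b * x) ^ n * exp (- (1 / 2) * x\<^sup>2)
            \<le> exp ((real n * ?b\<^sup>2 / 2 - 1 / 2) * x\<^sup>2 - real n * ((?b * x) ^ 4 / (12 * (1 + (?b * x)\<^sup>2))))"
          by (rule curie_weiss_weight_le)
        also have "\<dots> \<le> exp ((real n * ?b\<^sup>2 / 2 - 1 / 2) * x\<^sup>2)"
          by simp
        also have "\<dots> = w x"
          unfolding bn[OF elim] w_def by (simp add: field_simps)
        finally show "cosh (?b * x) ^ n * exp (- (1 / 2) * x\<^sup>2) \<le> w x" .
      qed
    qed
    show "(\<integral>x. w x \<partial>lborel) \<noteq> 0" using w_int \<beta> by simp
  qed (use b w_int in auto)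
  also have "(\<integral>x. cis (sqrt \<beta> * t * x) * of_real (w x) \<partial>lborel)
      = of_real (sqrt (2 * pi / (1 - \<beta>)) * exp (- (sqrt \<beta> * t)\<^sup>2 / (2 * (1 - \<beta>))))"
    unfolding w_def using \<beta> by (intro fourier_gaussian) simp
  also have "exp (complex_of_real (- (1 * t\<^sup>2) / 2)) *
        (of_real (sqrt (2 * pi / (1 - \<beta>)) * exp (- (sqrt \<beta> * t)\<^sup>2 / (2 * (1 - \<beta>)))) / of_real (\<integral>x. w x \<partial>lborel))
      = of_real (exp (- t\<^sup>2 / 2) * exp (- (sqrt \<beta> * t)\<^sup>2 / (2 * (1 - \<beta>))))"
    using \<beta> unfolding w_int(2) by (simp flip: exp_of_real)
  also have "exp (- t\<^sup>2 / 2) * exp (- (sqrt \<beta> * t)\<^sup>2 / (2 * (1 - \<beta>))) = exp (- t\<^sup>2 / (2 * (1 - \<beta>)))"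
  proof -
    have "- t\<^sup>2 / 2 + - (sqrt \<beta> * t)\<^sup>2 / (2 * (1 - \<beta>)) = - t\<^sup>2 / (2 * (1 - \<beta>))"
      using \<beta> by (simp add: power_mult_distrib field_simps)
    then show ?thesis by (simp flip: exp_add)
  qed
  also have "of_real (exp (- t\<^sup>2 / (2 * (1 - \<beta>))))
      = char (density lborel (\<lambda>x. ennreal (normal_density 0 (sqrt (1 / (1 - \<beta>))) x))) t"
    using \<beta> by (simp add: char_normal)
  finally show "(\<lambda>n. char (distr (curie_weiss n \<beta>) borel (\<lambda>x. magnetisation n x / sqrt (real n))) t)
      \<longlonglongrightarrow> char (density lborel (\<lambda>x. ennreal (normal_density 0 (sqrt (1 / (1 - \<beta>))) x))) t" .
qed

lemma quartic_weight_integral_nonzero: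
  "(\<integral>x. exp (- \<gamma> * x ^ 2 / 2 - x ^ 4 / 12) \<partial>lborel) \<noteq> (0 :: real)"
proof
  assume "(\<integral>x. exp (- \<gamma> * x ^ 2 / 2 - x ^ 4 / 12) \<partial>lborel) = (0 :: real)"
  \<comment> \<open>division by a vanishing normalising constant would make the density \<open>0\<close>\<close>
  then have "emeasure (quartic_law \<gamma>) UNIV = 0"
    by (simp add: quartic_law_def normalised_law_def emeasure_density)
  then show False
    using prob_space.emeasure_space_1[OF prob_space_quartic_law[of \<gamma>]]
    by (simp add: quartic_law_def normalised_law_def)
qed

text \<open>
  At the scale \<open>b = n powr (- 1 / 4)\<close> one has \<open>n b ^ 4 = 1\<close>, so the quartic term of \<open>ln cosh\<close> enters the limit with coefficient
  \<open>1 / 12\<close>, while the quadratic coefficient is \<open>sqrt n / 2 - sqrt n / (2 \<beta>) = - \<gamma> / (2 \<beta>)\<close>. The spin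
  fluctuations, of order \<open>sqrt n\<close>, are negligible against \<open>n powr (3 / 4)\<close>.
\<close>
lemma weak_conv_critical_window:
  fixes \<gamma> :: real
  shows "weak_conv_m
          (\<lambda>n. distr (curie_weiss n (1 - \<gamma> / sqrt (real n))) borel
                 (\<lambda>x. magnetisation n x / real n powr (3 / 4)))
          (quartic_law \<gamma>)"
proof (rule weak_conv_curie_weiss)
  interpret prob_space "quartic_law \<gamma>" by (rule prob_space_quartic_law)
  show "real_distribution (quartic_law \<gamma>)"
    by unfold_locales (auto simp: quartic_law_def normalised_law_def)
next
  fix t :: real
  define w where "w x = exp (- \<gamma> * x ^ 2 / 2 - x ^ 4 / 12)" for x :: real
  define \<beta> where "\<beta> n = 1 - \<gamma> / sqrt (real n)" for n :: nat
  define b where "b n = real n powr (- 1 / 4)" for n :: nat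
  define \<kappa> where "\<kappa> n = sqrt (real n) / (2 * \<beta> n)" for n :: nat
  define K where "K = 12 * (\<bar>\<gamma>\<bar> + 1)"
  define W where "W x = exp (K\<^sup>2 / 12) * exp (0 * x - 1 * x\<^sup>2)" for x :: real
  have b2: "real n * (b n)\<^sup>2 = sqrt (real n)" if "0 < n" for n
    using that by (simp add: b_def powr_power powr_half_sqrt[symmetric] powr_mult_base)
  have b4: "real n * b n ^ 4 = 1" if "0 < n" for n
    using that by (simp add: b_def powr_power powr_mult_base)
  have "\<beta> \<longlonglongrightarrow> 1 - \<gamma> * 0"
    unfolding \<beta>_def[abs_def] divide_inverse
    by (intro tendsto_intros) real_asymp
  then have \<beta>_lim: "\<beta> \<longlonglongrightarrow> 1" by simp
  have ev: "\<forall>\<^sub>F n in sequentially. 0 < n \<and> 1 / 2 < \<beta> n"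
    using eventually_conj[OF eventually_gt_at_top[of 0] order_tendstoD(1)[OF \<beta>_lim, of "1/2"]] by simp
  have coeff: "real n * (b n)\<^sup>2 / 2 - \<kappa> n = - \<gamma> / (2 * \<beta> n)" if "0 < n \<and> 1 / 2 < \<beta> n" for n
  proof -
    have "sqrt (real n) * (\<beta> n - 1) = - \<gamma>" using that by (simp add: \<beta>_def)
    then have "sqrt (real n) * \<beta> n - sqrt (real n) = - \<gamma>" by (simp add: algebra_simps)
    moreover have "real n * (b n)\<^sup>2 / 2 - \<kappa> n = (sqrt (real n) * \<beta> n - sqrt (real n)) / (2 * \<beta> n)"
      using that by (simp add: b2 \<kappa>_def field_simps)
    ultimately show ?thesis by simp
  qed
  have b: "b \<longlonglongrightarrow> 0"
    unfolding b_def[abs_def] by real_asymp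
  have "(\<lambda>n. char (distr (curie_weiss n (\<beta> n)) borel (\<lambda>x. magnetisation n x / real n powr (3 / 4))) t)
      \<longlonglongrightarrow> exp (complex_of_real (- (0 * t\<^sup>2) / 2)) *
        ((\<integral>x. cis (1 * t * x) * of_real (w x) \<partial>lborel) / of_real (\<integral>x. w x \<partial>lborel))"
  proof (rule char_curie_weiss_tendsto[where \<kappa> = \<kappa> and b = b and W = W])
    show "\<forall>\<^sub>F n in sequentially. 0 < \<kappa> n \<and> real n * (b n)\<^sup>2 = 2 * \<beta> n * \<kappa> n"
      using ev by eventually_elim (auto simp: b2 \<kappa>_def)
    show "(\<lambda>n. 1 / real n powr (3 / 4)) \<longlonglongrightarrow> 0"
      by real_asymp
    show "(\<lambda>n. real n / (real n powr (3 / 4))\<^sup>2) \<longlonglongrightarrow> 0"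
      by real_asymp
    show "(\<lambda>n. real n * b n / real n powr (3 / 4)) \<longlonglongrightarrow> 1"
      unfolding b_def by real_asymp
    show "(\<lambda>n. cosh (b n * x) ^ n * exp (- \<kappa> n * x\<^sup>2)) \<longlonglongrightarrow> w x" for x
    proof -
      have "(\<lambda>n. real n * b n ^ 4) \<longlonglongrightarrow> 1"
        by (rule tendsto_eventually) (use ev in eventually_elim, simp add: b4)
      moreover have "(\<lambda>n. real n * (b n)\<^sup>2 / 2 - \<kappa> n) \<longlonglongrightarrow> - \<gamma> / (2 * 1)"
      proof (rule Lim_transform_eventually)
        show "(\<lambda>n. - \<gamma> / (2 * \<beta> n)) \<longlonglongrightarrow> - \<gamma> / (2 * 1)"
          by (intro tendsto_intros \<beta>_lim) auto
        show "\<forall>\<^sub>F n in sequentially. - \<gamma> / (2 * \<beta> n) = real n * (b n)\<^sup>2 / 2 - \<kappa> n"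
          using ev by eventually_elim (simp only: coeff)
      qed
      ultimately have "(\<lambda>n. cosh (b n * x) ^ n * exp (- \<kappa> n * x\<^sup>2))
          \<longlonglongrightarrow> exp (- \<gamma> / (2 * 1) * x\<^sup>2 - 1 * x ^ 4 / 12)"
        by (rule tendsto_curie_weiss_weight[OF b])
      then show ?thesis by (simp add: w_def)
    qed
    \<comment> \<open>For \<open>sqrt n \<ge> K\<close> the quartic term is at least \<open>x ^ 4 / (12 (1 + x\<^sup>2 / K)) \<ge> K (x\<^sup>2 - K) / 12\<close>. This beats
      the quadratic term, whose sign depends on \<open>\<gamma>\<close>, because \<open>K / 12 = \<bar>\<gamma>\<bar> + 1\<close>.\<close>
    have "\<forall>\<^sub>F n in sequentially. K \<le> sqrt (real n)"
      by (rule filterlim_at_top[THEN iffD1, rule_format]) real_asymp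
    with ev show "\<forall>\<^sub>F n in sequentially. \<forall>x. cosh (b n * x) ^ n * exp (- \<kappa> n * x\<^sup>2) \<le> W x"
    proof eventually_elim
      case (elim n)
      have K: "0 < K" by (simp add: K_def)
      show ?case
      proof
        fix x :: real
        have "- \<gamma> / (2 * \<beta> n) \<le> \<bar>\<gamma>\<bar> / (2 * \<beta> n)"
          using elim by (intro divide_right_mono) auto
        also have "\<dots> \<le> \<bar>\<gamma>\<bar> / 1"
          using elim by (intro divide_left_mono) auto
        finally have "- \<gamma> / (2 * \<beta> n) * x\<^sup>2 \<le> \<bar>\<gamma>\<bar> * x\<^sup>2"
          by (intro mult_right_mono) auto
        moreover have "K / 12 * (x\<^sup>2 - K) \<le> real n * ((b n * x) ^ 4 / (12 * (1 + (b n * x)\<^sup>2)))"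
        proof -
          have "(b n)\<^sup>2 = 1 / sqrt (real n)"
          proof -
            have "sqrt (real n) * (sqrt (real n) * (b n)\<^sup>2) = sqrt (real n) * 1"
              using b2[of n] elim by (simp flip: mult.assoc)
            then have "sqrt (real n) * (b n)\<^sup>2 = 1"
              using elim by (subst (asm) mult_cancel_left) simp
            then show ?thesis using elim by (simp add: field_simps)
          qed
          then have "(b n)\<^sup>2 \<le> 1 / K"
            using K elim by (simp add: frac_le)
          then have le: "(b n * x)\<^sup>2 \<le> x\<^sup>2 / K"
            using mult_right_mono[of "(b n)\<^sup>2" "1 / K" "x\<^sup>2"] by (simp add: power_mult_distrib)
          have "real n * ((b n * x) ^ 4 / (12 * (1 + (b n * x)\<^sup>2))) = x ^ 4 / (12 * (1 + (b n * x)\<^sup>2))"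
            using b4[of n] elim by (simp add: power_mult_distrib mult.assoc[symmetric])
          also have "\<dots> \<ge> x ^ 4 / (12 * (1 + x\<^sup>2 / K))"
            using le by (intro divide_left_mono) (auto intro!: mult_pos_pos add_pos_nonneg simp: K less_imp_le)
          also have "x ^ 4 / (12 * (1 + x\<^sup>2 / K)) \<ge> K / 12 * (x\<^sup>2 - K)"
          proof -
            have "K / 12 * (x\<^sup>2 - K) * (12 * (1 + x\<^sup>2 / K)) = (x\<^sup>2 - K) * (x\<^sup>2 + K)"
              using K by (simp add: field_simps)
            also have "\<dots> \<le> x ^ 4"
              by (simp add: algebra_simps power2_eq_square power4_eq_xxxx)
            finally show ?thesis
              using K by (subst pos_le_divide_eq) (auto intro!: add_pos_nonneg)
          qed
          finally show ?thesis .
        qed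
        ultimately have "- \<gamma> / (2 * \<beta> n) * x\<^sup>2 - real n * ((b n * x) ^ 4 / (12 * (1 + (b n * x)\<^sup>2)))
            \<le> \<bar>\<gamma>\<bar> * x\<^sup>2 - K / 12 * (x\<^sup>2 - K)"
          by (rule diff_mono)
        also have "\<dots> = K\<^sup>2 / 12 - x\<^sup>2"
          by (simp add: K_def field_simps power2_eq_square)
        finally have "exp (- \<gamma> / (2 * \<beta> n) * x\<^sup>2 - real n * ((b n * x) ^ 4 / (12 * (1 + (b n * x)\<^sup>2)))) \<le> W x"
          by (simp add: W_def exp_add[symmetric])
        with curie_weiss_weight_le[of "b n" x n "\<kappa> n"]
        show "cosh (b n * x) ^ n * exp (- \<kappa> n * x\<^sup>2) \<le> W x"
          using elim by (simp only: coeff)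
      qed
    qed
    show "integrable lborel W"
      unfolding W_def by (intro integrable_mult_right gaussian_laplace_transform(1)) simp
    show "w \<in> borel_measurable borel"
      unfolding w_def[abs_def] by measurable
    show "(\<integral>x. w x \<partial>lborel) \<noteq> 0"
      unfolding w_def by (rule quartic_weight_integral_nonzero)
  qed (fact b)
  then show "(\<lambda>n. char (distr (curie_weiss n (1 - \<gamma> / sqrt (real n))) borel
                 (\<lambda>x. magnetisation n x / real n powr (3 / 4))) t) \<longlonglongrightarrow> char (quartic_law \<gamma>) t"
    unfolding quartic_law_def by (subst char_normalised_law) (auto simp: w_def \<beta>_def)
qed

section \<open>The quartic law and the Gamma law\<close>

lemma lborel_integral_fold_reflection:
  fixes f :: "real \<Rightarrow> 'b::{banach, second_countable_topology}"
  assumes f: "integrable lborel f"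
  shows "(\<integral>x. f x \<partial>lborel) = (\<integral>x. indicator {0<..} x *\<^sub>R (f x + f (- x)) \<partial>lborel)"
proof -
  have [measurable]: "f \<in> borel_measurable borel" using f by auto
  have int: "integrable lborel (\<lambda>x. indicator A x *\<^sub>R f x)" if "A \<in> sets borel" for A
    using f that by (intro integrable_mult_indicator) auto
  have int': "integrable lborel (\<lambda>x. indicator {0<..} x *\<^sub>R f (- x))"
    using lborel_integrable_real_affine[OF f, of "-1" 0] by (intro integrable_mult_indicator) auto
  have "(\<integral>x. f x \<partial>lborel) = (\<integral>x. indicator {0<..} x *\<^sub>R f x + indicator {..<0} x *\<^sub>R f x \<partial>lborel)"
    using AE_lborel_singleton[of 0]
    by (intro integral_cong_AE) (auto simp: indicator_def)
  also have "\<dots> = (\<integral>x. indicator {0<..} x *\<^sub>R f x \<partial>lborel) + (\<integral>x. indicator {..<0} x *\<^sub>R f x \<partial>lborel)"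
    by (intro Bochner_Integration.integral_add int) auto
  also have "(\<integral>x. indicator {..<0} x *\<^sub>R f x \<partial>lborel)
      = \<bar>-1\<bar> *\<^sub>R (\<integral>x. indicator {..<0} (0 + (-1) * x) *\<^sub>R f (0 + (-1) * x) \<partial>lborel)"
    by (rule lborel_integral_real_affine) simp
  also have "\<dots> = (\<integral>x. indicator {0<..} x *\<^sub>R f (- x) \<partial>lborel)"
    by (auto simp: indicator_def intro!: Bochner_Integration.integral_cong)
  also have "(\<integral>x. indicator {0<..} x *\<^sub>R f x \<partial>lborel) + \<dots>
      = (\<integral>x. indicator {0<..} x *\<^sub>R (f x + f (- x)) \<partial>lborel)"
    unfolding scaleR_add_right using int int'
    by (intro Bochner_Integration.integral_add[symmetric]) auto
  finally show ?thesis .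
qed

text \<open>
  A function that is not integrable has integral \<open>0\<close> by convention, so a nonzero integral is enough.
\<close>
lemma integrable_quartic_weight:
  "integrable lborel (\<lambda>x. exp (- \<gamma> * x ^ 2 / 2 - x ^ 4 / 12) :: real)"
  by (rule ccontr) (use quartic_weight_integral_nonzero[of \<gamma>] in \<open>simp add: not_integrable_integral_eq\<close>)

text \<open>
  The substitution \<open>y = x ^ 4 / 12\<close> turns \<open>y powr (- 3 / 4) * exp (- y) dy\<close> into a multiple of \<open>exp (- x ^ 4 / 12) dx\<close>, so the two
  distribution functions are proportional. Both tend to \<open>1\<close> at infinity, hence they agree, and
  the value of the constant never has to be computed.
\<close>
lemma normalised_law_quartic_root_gamma:
  "distr (gamma_law (1 / 4)) borel (\<lambda>g. (12 * g) powr (1 / 4))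
    = normalised_law (\<lambda>x. indicator {0<..} x * exp (- (x ^ 4) / 12))" (is "?\<rho> = ?\<mu>")
proof -
  define N where "N = (\<integral>x. indicator {0<..} x * (x powr (1 / 4 - 1) * exp (- x)) \<partial>(lborel :: real measure))"
  define Z where "Z = (\<integral>x. indicator {0<..} x * exp (- (x ^ 4) / 12) \<partial>(lborel :: real measure))"
  define C where "C = 12 powr (3 / 4) / 3 / N"
  define f where "f y = indicator {0<..} y * (y powr (1 / 4 - 1) * exp (- y)) / N" for y :: real
  define J where "J r = (\<integral>\<^sup>+x. ennreal (exp (- (x ^ 4) / 12)) * indicator {0<..r} x \<partial>lborel)" for r :: real
  have [measurable]: "f \<in> borel_measurable borel"
    unfolding f_def[abs_def] by measurable
  have \<gamma>: "gamma_law (1 / 4) = density lborel (\<lambda>x. ennreal (f x))"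
    by (simp add: gamma_law_def normalised_law_def f_def N_def)
  have int: "integrable lborel (\<lambda>x::real. indicator {0<..} x * exp (- (x ^ 4) / 12))"
    using integrable_mult_indicator[OF _ integrable_quartic_weight[of 0], of "{0<..}"] by simp
  have "Z \<noteq> 0"
    unfolding Z_def by (rule integral_pos_imp_nonzero[OF int]) auto
  moreover have "0 \<le> Z"
    unfolding Z_def by (rule Bochner_Integration.integral_nonneg) auto
  ultimately have Z: "0 < Z" by simp
  have "0 \<le> N"
    unfolding N_def by (rule Bochner_Integration.integral_nonneg) auto
  then have C: "0 \<le> C" by (simp add: C_def)
  interpret \<gamma>: prob_space "gamma_law (1 / 4)"
    by (rule prob_space_gamma_law) simp
  have [simp]: "sets (gamma_law (1 / 4)) = sets borel" "space (gamma_law (1 / 4)) = UNIV"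
    by (simp_all add: \<gamma>)
  have meas: "(\<lambda>g. (12 * g) powr (1 / 4)) \<in> measurable (gamma_law (1 / 4)) borel"
    by (simp add: \<gamma>)
  have \<rho>: "real_distribution ?\<rho>"
    using meas by (rule \<gamma>.real_distribution_distr)
  interpret \<mu>: prob_space ?\<mu>
    by (rule prob_space_normalised_law) (use int \<open>Z \<noteq> 0\<close> in \<open>auto simp: Z_def\<close>)
  have \<mu>: "real_distribution ?\<mu>"
    by unfold_locales (auto simp: normalised_law_def)
  have em_\<mu>: "emeasure ?\<mu> {..r} = ennreal (1 / Z) * J r" for r
  proof -
    have "emeasure ?\<mu> {..r} = (\<integral>\<^sup>+x. ennreal (indicator {0<..} x * exp (- (x ^ 4) / 12) / Z) * indicator {..r} x \<partial>lborel)"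
      unfolding normalised_law_def Z_def by (subst emeasure_density) auto
    also have "\<dots> = (\<integral>\<^sup>+x. ennreal (1 / Z) * (ennreal (exp (- (x ^ 4) / 12)) * indicator {0<..r} x) \<partial>lborel)"
      using Z by (intro nn_integral_cong) (auto simp: indicator_def ennreal_mult[symmetric])
    also have "\<dots> = ennreal (1 / Z) * J r"
      unfolding J_def by (rule nn_integral_cmult) measurable
    finally show ?thesis .
  qed
  have em_\<rho>: "emeasure ?\<rho> {..r} = ennreal C * J r" for r
  proof -
    have "emeasure ?\<rho> {..r} = emeasure (gamma_law (1 / 4)) {g. (12 * g) powr (1 / 4) \<le> r}"
      using meas by (subst emeasure_distr) (auto simp: vimage_def)
    also have "\<dots> = (\<integral>\<^sup>+y. ennreal (f y) * indicator {g. (12 * g) powr (1 / 4) \<le> r} y \<partial>lborel)"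
      unfolding \<gamma> by (rule emeasure_density) auto
    finally have em: "emeasure ?\<rho> {..r} = (\<integral>\<^sup>+y. ennreal (f y) * indicator {g. (12 * g) powr (1 / 4) \<le> r} y \<partial>lborel)" .
    show ?thesis
    proof (cases "0 < r")
      case True
      have "(12 * y) powr (1 / 4) \<le> r \<longleftrightarrow> y \<le> r ^ 4 / 12" if "0 < y" for y
      proof -
        have "(12 * y) powr (1 / 4) \<le> r \<longleftrightarrow> ((12 * y) powr (1 / 4)) ^ 4 \<le> r ^ 4"
          using True by (intro power_mono_iff[symmetric]) auto
        also have "((12 * y) powr (1 / 4)) ^ 4 = 12 * y"
          using that by (simp add: powr_power)
        finally show ?thesis by auto
      qed
      then have "emeasure ?\<rho> {..r} = (\<integral>\<^sup>+y. ennreal (f y * indicator {0 ^ 4 / 12..r ^ 4 / 12} y) \<partial>lborel)"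
        unfolding em by (intro nn_integral_cong) (auto simp: f_def indicator_def)
      also have "\<dots> = (\<integral>\<^sup>+x. ennreal (f (x ^ 4 / 12) * (x ^ 3 / 3) * indicator {0..r} x) \<partial>lborel)"
        using True
        by (intro nn_integral_substitution)
          (auto intro!: derivative_eq_intros continuous_intros simp: set_borel_measurable_def power3_eq_cube)
      also have "\<dots> = (\<integral>\<^sup>+x. ennreal C * (ennreal (exp (- (x ^ 4) / 12)) * indicator {0<..r} x) \<partial>lborel)"
      proof (intro nn_integral_cong)
        fix x :: real
        have "f (x ^ 4 / 12) * (x ^ 3 / 3) = C * exp (- (x ^ 4) / 12)" if "0 < x"
        proof -
          have x4: "x ^ 4 = x powr 4"
            using that by (simp add: powr_numeral)
          have "(x ^ 4 / 12) powr (1 / 4 - 1) = (x powr 4) powr (- (3 / 4)) / 12 powr (- (3 / 4))"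
            unfolding x4 using that by (subst powr_divide) auto
          also have "(x powr 4) powr (- (3 / 4)) = x powr (- 3)"
            by (simp only: powr_powr) simp
          also have "\<dots> = 1 / x ^ 3"
            using that by (subst powr_minus_divide) (simp add: powr_numeral)
          finally have "(x ^ 4 / 12) powr (1 / 4 - 1) = 12 powr (3 / 4) / x ^ 3"
            by (simp only: powr_minus_divide) simp
          then have "(x ^ 4 / 12) powr (1 / 4 - 1) * (x ^ 3 / 3) = 12 powr (3 / 4) / 3"
            using that by simp
          then have "(x ^ 4 / 12) powr (1 / 4 - 1) * (x ^ 3 / 3) * (exp (- (x ^ 4 / 12)) / N) = 12 powr (3 / 4) / 3 * (exp (- (x ^ 4 / 12)) / N)"
            by (rule arg_cong)
          then show ?thesis using that by (simp add: f_def C_def mult_ac)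
        qed
        then show "ennreal (f (x ^ 4 / 12) * (x ^ 3 / 3) * indicator {0..r} x)
            = ennreal C * (ennreal (exp (- (x ^ 4) / 12)) * indicator {0<..r} x)"
          using C by (cases "x = 0") (auto simp: indicator_def ennreal_mult[symmetric] f_def)
      qed
      also have "\<dots> = ennreal C * J r"
        unfolding J_def by (rule nn_integral_cmult) measurable
      finally show ?thesis .
    next
      case False
      have zero: "ennreal (f y) * indicator {g. (12 * g) powr (1 / 4) \<le> r} y = 0" for y
      proof (cases "0 < y")
        case True
        then have "0 < (12 * y) powr (1 / 4)" by simp
        with False have "\<not> (12 * y) powr (1 / 4) \<le> r" by linarith
        then show ?thesis by simp
      qed (simp add: f_def)
      have "emeasure ?\<rho> {..r} = 0"
        unfolding em zero by simp
      moreover have "J r = 0"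
        using False by (simp add: J_def)
      ultimately show ?thesis by simp
    qed
  qed
  have cdf: "cdf ?\<rho> r = C * Z * cdf ?\<mu> r" for r
  proof -
    have "ennreal C * J r = ennreal (C * Z) * (ennreal (1 / Z) * J r)"
      using C Z by (simp add: mult.assoc[symmetric] ennreal_mult[symmetric])
    then have "emeasure ?\<rho> {..r} = ennreal (C * Z) * emeasure ?\<mu> {..r}"
      by (simp only: em_\<mu> em_\<rho>)
    then show ?thesis
      using C Z by (simp add: cdf_def measure_def enn2real_mult)
  qed
  have "((\<lambda>r. C * Z * cdf ?\<mu> r) \<longlongrightarrow> C * Z * 1) at_top"
    using real_distribution.cdf_lim_at_top_prob[OF \<mu>] by (rule tendsto_mult_left)
  moreover have "cdf ?\<rho> = (\<lambda>r. C * Z * cdf ?\<mu> r)"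
    using cdf by (rule ext)
  then have "((\<lambda>r. C * Z * cdf ?\<mu> r) \<longlongrightarrow> 1) at_top"
    using real_distribution.cdf_lim_at_top_prob[OF \<rho>] by (simp only:)
  ultimately have "C * Z * 1 = 1"
    by (rule tendsto_unique[OF trivial_limit_at_top_linorder])
  then have "cdf ?\<rho> = cdf ?\<mu>"
    using cdf by (auto simp: fun_eq_iff)
  with \<rho> \<mu> show ?thesis by (rule cdf_unique)
qed

text \<open>
  A fair sign symmetrises the law of the root, and the quartic density is even: both characteristic functions
  reduce to the same integral over the half-line.
\<close>
lemma quartic_law_representation:
  fixes \<Omega> :: "'a measure" and B G :: "'a \<Rightarrow> real"
  assumes "prob_space \<Omega>" and ind: "prob_space.indep_var \<Omega> borel B borel G"
    and B: "distr \<Omega> borel B = uniform_sign" and G: "distr \<Omega> borel G = gamma_law (1 / 4)"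
  shows "distr \<Omega> borel (\<lambda>\<omega>. B \<omega> * (12 * G \<omega>) powr (1 / 4)) = quartic_law 0"
proof -
  interpret prob_space \<Omega> by fact
  interpret U: prob_space uniform_sign by (rule prob_space_uniform_sign)
  interpret \<Gamma>: prob_space "gamma_law (1 / 4)" by (rule prob_space_gamma_law) simp
  interpret P: pair_prob_space uniform_sign "gamma_law (1 / 4)" ..
  interpret Q: prob_space "quartic_law 0" by (rule prob_space_quartic_law)
  have [measurable_cong, simp]: "sets (gamma_law (1 / 4)) = sets borel"
    by (simp add: gamma_law_def normalised_law_def)
  have [measurable]: "B \<in> borel_measurable \<Omega>" "G \<in> borel_measurable \<Omega>"
    and joint: "distr \<Omega> (borel \<Otimes>\<^sub>M borel) (\<lambda>\<omega>. (B \<omega>, G \<omega>)) = uniform_sign \<Otimes>\<^sub>M gamma_law (1 / 4)"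
    using ind unfolding indep_var_distribution_eq B G by auto
  let ?h = "\<lambda>x::real. exp (- (x ^ 4) / 12)"
  let ?X = "\<lambda>g::real. (12 * g) powr (1 / 4)"
  define \<rho> where "\<rho> = distr (gamma_law (1 / 4)) borel ?X"
  have int_h: "integrable lborel ?h"
    using integrable_quartic_weight[of 0] by simp
  have char_\<rho>: "char \<rho> t = (\<integral>x. cis (t * x) * of_real (indicator {0<..} x * ?h x) \<partial>lborel)
      / of_real (\<integral>x. indicator {0<..} x * ?h x \<partial>lborel)" for t
    unfolding \<rho>_def normalised_law_quartic_root_gamma by (rule char_normalised_law) auto
  have int_cis: "integrable lborel (\<lambda>x. cis (t * x) * complex_of_real (?h x))" for t
    by (rule Bochner_Integration.integrable_bound[OF int_h]) (auto simp: norm_mult cis_conv_exp)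
  have int_cis_pos: "integrable lborel (\<lambda>x. cis (t * x) * complex_of_real (indicator {0<..} x * ?h x))" for t
    by (rule Bochner_Integration.integrable_bound[OF int_h])
      (auto simp: norm_mult cis_conv_exp indicator_def)
  have "char (distr \<Omega> borel (\<lambda>\<omega>. B \<omega> * ?X (G \<omega>))) t = char (quartic_law 0) t" for t
  proof -
    have "char (distr \<Omega> borel (\<lambda>\<omega>. B \<omega> * ?X (G \<omega>))) t
        = (\<integral>p. iexp (t * (fst p * ?X (snd p))) \<partial>distr \<Omega> (borel \<Otimes>\<^sub>M borel) (\<lambda>\<omega>. (B \<omega>, G \<omega>)))"
      unfolding char_def by (subst (1 2) integral_distr) auto
    also have "\<dots> = (\<integral>b. \<integral>g. iexp (t * (b * ?X g)) \<partial>gamma_law (1 / 4) \<partial>uniform_sign)"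
      unfolding joint
      by (subst P.integral_fst'[symmetric])
        (auto intro!: P.integrable_const_bound[where B = 1])
    also have "\<dots> = (1 / 2) *\<^sub>R (char \<rho> t + char \<rho> (- t))"
      by (subst integral_uniform_sign) (auto simp: char_def \<rho>_def integral_distr)
    also have "\<dots> = (\<integral>x. cis (t * x) * of_real (?h x) \<partial>lborel) / of_real (\<integral>x. ?h x \<partial>lborel)"
    proof -
      have "(\<integral>x. cis (t * x) * of_real (?h x) \<partial>lborel)
          = (\<integral>x. indicator {0<..} x *\<^sub>R (cis (t * x) * of_real (?h x) + cis (t * - x) * of_real (?h (- x))) \<partial>lborel)"
        by (rule lborel_integral_fold_reflection[OF int_cis])
      also have "\<dots> = (\<integral>x. cis (t * x) * of_real (indicator {0<..} x * ?h x)
          + cis (- t * x) * of_real (indicator {0<..} x * ?h x) \<partial>lborel)"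
        by (intro Bochner_Integration.integral_cong) (auto simp: indicator_def)
      also have "\<dots> = (\<integral>x. cis (t * x) * of_real (indicator {0<..} x * ?h x) \<partial>lborel)
          + (\<integral>x. cis (- t * x) * of_real (indicator {0<..} x * ?h x) \<partial>lborel)"
        by (rule Bochner_Integration.integral_add[OF int_cis_pos int_cis_pos])
      finally have num: "(\<integral>x. cis (t * x) * of_real (?h x) \<partial>lborel) = \<dots>" .
      have "(\<integral>x. ?h x \<partial>lborel) = (\<integral>x. indicator {0<..} x *\<^sub>R (?h x + ?h (- x)) \<partial>lborel)"
        by (rule lborel_integral_fold_reflection[OF int_h])
      also have "\<dots> = (\<integral>x. 2 * (indicator {0<..} x * ?h x) \<partial>lborel)"
        by (intro Bochner_Integration.integral_cong) auto
      also have "\<dots> = 2 * (\<integral>x. indicator {0<..} x * ?h x \<partial>lborel)"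
        by (rule integral_mult_right_zero)
      finally have den: "(\<integral>x. ?h x \<partial>lborel) = \<dots>" .
      show ?thesis
        unfolding num den char_\<rho> by (simp add: scaleR_conv_of_real add_divide_distrib mult.commute)
    qed
    also have "\<dots> = char (quartic_law 0) t"
      unfolding quartic_law_def by (subst char_normalised_law) auto
    finally show ?thesis .
  qed
  moreover have "real_distribution (distr \<Omega> borel (\<lambda>\<omega>. B \<omega> * ?X (G \<omega>)))"
    by (rule real_distribution_distr) measurable
  moreover have "real_distribution (quartic_law 0)"
    by unfold_locales (auto simp: quartic_law_def normalised_law_def)
  ultimately show ?thesis
    by (intro Levy_uniqueness) auto
qed

section \<open>Laplace's method at low temperature\<close>

text \<open>
  The sign of the derivative is that of \<open>x - sinh x * cosh x\<close>.
\<close>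
lemma tanh_div_strict_antimono:
  fixes u v :: real
  assumes "0 < u" "u < v"
  shows "tanh v / v < tanh u / u"
proof (rule DERIV_neg_imp_decreasing[OF assms(2)])
  fix x :: real
  assume "u \<le> x"
  with assms have x: "0 < x" by simp
  have D: "((\<lambda>x. tanh x / x) has_real_derivative ((1 - tanh x ^ 2) * x - tanh x) / (x * x)) (at x)"
    using x by (auto intro!: derivative_eq_intros)
  have "x * 1 < sinh x * cosh x"
  proof (rule mult_le_less_imp_less)
    show "1 < cosh x"
      using x cosh_real_ge_1[of x] cosh_real_one_iff[of x] by (simp add: less_le)
  qed (use x le_sinh_real[of x] in auto)
  then have "1 / (cosh x)\<^sup>2 * x < tanh x"
    by (simp add: tanh_def divide_simps power2_eq_square mult_ac)
  moreover have "1 - tanh x ^ 2 = 1 / (cosh x)\<^sup>2"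
  proof -
    have "1 - tanh x ^ 2 = ((cosh x)\<^sup>2 - (sinh x)\<^sup>2) / (cosh x)\<^sup>2"
      by (simp add: tanh_def power_divide diff_divide_distrib)
    then show ?thesis by (simp only: hyperbolic_pythagoras)
  qed
  ultimately have "(1 - tanh x ^ 2) * x - tanh x < 0" by simp
  then have "((1 - tanh x ^ 2) * x - tanh x) / (x * x) < 0"
    using x by (intro divide_neg_pos) auto
  with D show "\<exists>y. ((\<lambda>x. tanh x / x) has_real_derivative y) (at x) \<and> y < 0" by blast
qed

text \<open>
  The map \<open>v \<mapsto> tanh v / v\<close> decreases strictly from its limit \<open>1\<close> at \<open>0\<close> and is below \<open>1 / \<beta>\<close> at \<open>v = \<beta>\<close>, so it takes the value
  \<open>1 / \<beta> < 1\<close> exactly once. The two sign conditions say that \<open>ln cosh v - v\<^sup>2 / (2 \<beta>)\<close> increases up to \<open>u\<close> and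
  decreases afterwards.
\<close>
lemma tanh_fixed_point:
  fixes \<beta> :: real
  assumes \<beta>: "1 < \<beta>"
  obtains u where "0 < u" "tanh u = u / \<beta>"
    "\<And>v. 0 < v \<Longrightarrow> v < u \<Longrightarrow> v / \<beta> < tanh v" "\<And>v. u < v \<Longrightarrow> tanh v < v / \<beta>"
proof -
  have "\<forall>\<^sub>F v in at_right 0. tanh v / v ^ 1 > 1 / \<beta>"
    using \<beta> by (intro order_tendstoD(1)[OF filterlim_at_split[THEN iffD1, OF tendsto_tanh_linear, THEN conjunct2]]) auto
  moreover have "\<forall>\<^sub>F v :: real in at_right 0. 0 < v \<and> v < \<beta>"
    using \<beta> eventually_at_right_less[of 0] eventually_at_right[of 0 \<beta>] by (auto intro!: exI[of _ \<beta>])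
  ultimately have "\<forall>\<^sub>F v in at_right 0. (0 < v \<and> v < \<beta>) \<and> tanh v / v > 1 / \<beta>"
    by eventually_elim simp
  then obtain v0 where v0: "0 < v0" "v0 < \<beta>" "1 / \<beta> < tanh v0 / v0"
    using eventually_happens[of _ "at_right (0::real)"] by auto
  have "tanh \<beta> / \<beta> \<le> 1 / \<beta>"
    using \<beta> tanh_real_lt_1[of \<beta>] by (intro divide_right_mono) auto
  then have "\<exists>u\<ge>v0. u \<le> \<beta> \<and> tanh u / u = 1 / \<beta>"
    using v0 by (intro IVT2') (auto intro!: continuous_intros)
  then obtain u where "v0 \<le> u" and u_eq: "tanh u / u = 1 / \<beta>"
    by blast
  with v0(1) have u: "0 < u" "tanh u / u = 1 / \<beta>" by auto
  show thesis
  proof (rule that[of u])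
    show "tanh u = u / \<beta>" using u \<beta> by (simp add: field_simps)
    show "v / \<beta> < tanh v" if "0 < v" "v < u" for v
      using tanh_div_strict_antimono[OF that] u(2) that \<beta> by (simp add: field_simps)
    show "tanh v < v / \<beta>" if "u < v" for v
      using tanh_div_strict_antimono[OF u(1) that] u that \<beta> by (simp add: field_simps)
  qed fact
qed

text \<open>
  Laplace's method. The hypothesis \<open>gap\<close> allows several maximisers of \<open>h\<close>: it asks that \<open>F\<close> be close to
  \<open>L\<close> wherever \<open>h\<close> is close to its maximum, so for an even \<open>h\<close> an even \<open>F\<close> can be handled on the whole line.
  Where \<open>F\<close> is far from \<open>L\<close>, the integrand is at most of order \<open>exp (n (h p - \<eta>))\<close>, whereas by continuity the
  normalising integral is at least of order \<open>exp (n (h p - \<eta> / 2))\<close>.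
\<close>
lemma laplace_concentration:
  fixes h F :: "real \<Rightarrow> real"
  assumes h: "continuous_on UNIV h" and int: "\<And>n. 0 < n \<Longrightarrow> integrable lborel (\<lambda>x. exp (real n * h x))"
    and [measurable]: "F \<in> borel_measurable borel" and F: "\<And>x. \<bar>F x\<bar> \<le> 1" and L: "\<bar>L\<bar> \<le> 1"
    and gap: "\<And>\<epsilon>. 0 < \<epsilon> \<Longrightarrow> \<exists>\<eta>>0. \<forall>x. \<epsilon> \<le> \<bar>F x - L\<bar> \<longrightarrow> h x \<le> h p - \<eta>"
  shows "(\<lambda>n. (\<integral>x. F x * exp (real n * h x) \<partial>lborel) / (\<integral>x. exp (real n * h x) \<partial>lborel)) \<longlonglongrightarrow> L"
proof (rule LIMSEQ_I)
  fix e :: real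
  assume "0 < e"
  define \<epsilon> where "\<epsilon> = e / 2"
  have \<epsilon>: "0 < \<epsilon>" using \<open>0 < e\<close> by (simp add: \<epsilon>_def)
  obtain \<eta> where \<eta>: "0 < \<eta>" "\<And>x. \<epsilon> \<le> \<bar>F x - L\<bar> \<Longrightarrow> h x \<le> h p - \<eta>"
    using gap[OF \<epsilon>] by auto
  have "isCont h p" using h by (simp add: continuous_on_eq_continuous_at)
  then have "\<exists>r>0. \<forall>x. norm (x - p) < r \<longrightarrow> \<bar>h x - h p\<bar> < \<eta> / 2"
    using half_gt_zero[OF \<eta>(1)] unfolding continuous_at_real_range by blast
  then obtain r' where r': "0 < r'" "\<And>x. \<bar>x - p\<bar> < r' \<Longrightarrow> \<bar>h x - h p\<bar> < \<eta> / 2"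
    by auto
  define r where "r = r' / 2"
  have r: "0 < r" "\<And>x. x \<in> {p..p + r} \<Longrightarrow> h p - \<eta> / 2 \<le> h x"
  proof -
    show "0 < r" using r'(1) by (simp add: r_def)
    show "h p - \<eta> / 2 \<le> h x" if "x \<in> {p..p + r}" for x
    proof -
      have "\<bar>x - p\<bar> < r'" using r'(1) that by (auto simp: r_def)
      from r'(2)[OF this] show ?thesis by linarith
    qed
  qed
  define D where "D n = (\<integral>x. exp (real n * h x) \<partial>lborel)" for n
  have D_lower: "r * exp (real n * (h p - \<eta> / 2)) \<le> D n" if "0 < n" for n
  proof -
    have "(\<integral>x. indicator {p..p + r} x * exp (real n * (h p - \<eta> / 2)) \<partial>lborel) \<le> D n"
      unfolding D_def
    proof (rule integral_mono[OF _ int[OF that]])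
      show "integrable lborel (\<lambda>x. indicator {p..p + r} x * exp (real n * (h p - \<eta> / 2)))"
        by (intro integrable_mult_left integrable_real_indicator) (auto simp: emeasure_lborel_Icc_eq)
      show "indicator {p..p + r} x * exp (real n * (h p - \<eta> / 2)) \<le> exp (real n * h x)" for x
        using r(2)[of x] by (auto simp: indicator_def mult_left_mono)
    qed
    then show ?thesis using r(1) by simp
  qed
  have "(\<lambda>n. 2 * D 1 * exp (\<eta> - h p) / r * exp (- (\<eta> / 2)) ^ n) \<longlonglongrightarrow> 2 * D 1 * exp (\<eta> - h p) / r * 0"
    using \<eta>(1) by (intro tendsto_mult tendsto_const LIMSEQ_power_zero) auto
  then have "\<forall>\<^sub>F n in sequentially. 2 * D 1 * exp (\<eta> - h p) / r * exp (- (\<eta> / 2)) ^ n < \<epsilon>"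
    using \<epsilon> by (intro order_tendstoD(2)) auto
  then have "\<forall>\<^sub>F n in sequentially. 0 < n \<and> 2 * D 1 * exp (\<eta> - h p) / r * exp (- (\<eta> / 2)) ^ n < \<epsilon>"
    using eventually_gt_at_top[of 0] by eventually_elim simp
  then obtain N where N: "\<And>n. N \<le> n \<Longrightarrow> 0 < n \<and> 2 * D 1 * exp (\<eta> - h p) / r * exp (- (\<eta> / 2)) ^ n < \<epsilon>"
    by (auto simp: eventually_sequentially)
  have [measurable]: "h \<in> borel_measurable borel"
    using h by (rule borel_measurable_continuous_onI)
  show "\<exists>N. \<forall>n\<ge>N. norm ((\<integral>x. F x * exp (real n * h x) \<partial>lborel) / (\<integral>x. exp (real n * h x) \<partial>lborel) - L) < e"
  proof (intro exI allI impI)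
    fix n
    assume "N \<le> n"
    then have n: "0 < n" and small: "2 * D 1 * exp (\<eta> - h p) / r * exp (- (\<eta> / 2)) ^ n < \<epsilon>"
      using N by auto
    have Dpos: "0 < D n"
    proof -
      have "0 < r * exp (real n * (h p - \<eta> / 2))" using r(1) by simp
      also have "\<dots> \<le> D n" by (rule D_lower[OF n])
      finally show ?thesis .
    qed
    have intF: "integrable lborel (\<lambda>x. F x * exp (real n * h x))"
      by (rule Bochner_Integration.integrable_bound[OF int[OF n]]) (use F in \<open>auto simp: abs_mult mult_le_cancel_right1\<close>)
    have "(\<integral>x. F x * exp (real n * h x) \<partial>lborel) - L * D n = (\<integral>x. (F x - L) * exp (real n * h x) \<partial>lborel)"
      unfolding D_def left_diff_distrib using intF int[OF n] by simp
    also have "\<bar>\<dots>\<bar> \<le> (\<integral>x. \<epsilon> * exp (real n * h x) + 2 * exp (\<eta> - h p) * exp (real n * (h p - \<eta>)) * exp (real 1 * h x) \<partial>lborel)"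
    proof (rule integral_abs_bound[THEN order_trans], rule integral_mono)
      show "integrable lborel (\<lambda>x. \<bar>(F x - L) * exp (real n * h x)\<bar>)"
        unfolding left_diff_distrib using intF int[OF n] by simp
      show "integrable lborel (\<lambda>x. \<epsilon> * exp (real n * h x) + 2 * exp (\<eta> - h p) * exp (real n * (h p - \<eta>)) * exp (real 1 * h x))"
        using int[OF n] int[of 1] by simp
      fix x
      show "\<bar>(F x - L) * exp (real n * h x)\<bar> \<le> \<epsilon> * exp (real n * h x) + 2 * exp (\<eta> - h p) * exp (real n * (h p - \<eta>)) * exp (real 1 * h x)"
      proof (cases "\<epsilon> \<le> \<bar>F x - L\<bar>")
        case False
        then have "\<bar>F x - L\<bar> * exp (real n * h x) \<le> \<epsilon> * exp (real n * h x)"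
          by (intro mult_right_mono) auto
        then show ?thesis by (simp add: abs_mult add_increasing2)
      next
        case True
        have "\<bar>F x - L\<bar> \<le> 2" using F[of x] L by linarith
        \<comment> \<open>One factor \<open>exp (h x)\<close> is kept to have an integrable bound; the other \<open>n - 1\<close> are replaced by the gap.\<close>
        have "real (n - 1) * h x \<le> real (n - 1) * (h p - \<eta>)"
          using \<eta>(2)[OF True] by (intro mult_left_mono) auto
        then have "real n * h x \<le> (\<eta> - h p) + real n * (h p - \<eta>) + h x"
          using n by (simp add: of_nat_diff algebra_simps)
        then have "exp (real n * h x) \<le> exp (\<eta> - h p) * exp (real n * (h p - \<eta>)) * exp (h x)"
          by (simp flip: exp_add)
        then have "\<bar>F x - L\<bar> * exp (real n * h x) \<le> 2 * (exp (\<eta> - h p) * exp (real n * (h p - \<eta>)) * exp (h x))"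
          using \<open>\<bar>F x - L\<bar> \<le> 2\<close> by (intro mult_mono) auto
        then show ?thesis using \<epsilon> by (simp add: abs_mult add_increasing mult.assoc)
      qed
    qed
    also have "\<dots> = \<epsilon> * D n + 2 * exp (\<eta> - h p) * exp (real n * (h p - \<eta>)) * D 1"
      unfolding D_def
      by (subst Bochner_Integration.integral_add[OF integrable_mult_right[OF int[OF n]] integrable_mult_right[OF int[of 1]]])
        (simp_all only: integral_mult_right_zero zero_less_one)
    also have "2 * exp (\<eta> - h p) * exp (real n * (h p - \<eta>)) * D 1
        = (2 * D 1 * exp (\<eta> - h p) / r * exp (- (\<eta> / 2)) ^ n) * (r * exp (real n * (h p - \<eta> / 2)))"
    proof -
      have "exp (real n * (h p - \<eta>)) = exp (- (\<eta> / 2)) ^ n * exp (real n * (h p - \<eta> / 2))"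
        by (simp add: exp_of_nat_mult[symmetric] exp_add[symmetric] algebra_simps)
      then show ?thesis using r(1) by simp
    qed
    also have "\<dots> < \<epsilon> * (r * exp (real n * (h p - \<eta> / 2)))"
      using small r(1) by (intro mult_strict_right_mono) auto
    also have "\<dots> \<le> \<epsilon> * D n"
      using D_lower[OF n] \<epsilon> by (intro mult_left_mono) auto
    finally have "\<bar>(\<integral>x. F x * exp (real n * h x) \<partial>lborel) - L * D n\<bar> < e * D n"
      by (simp add: \<epsilon>_def)
    moreover have "(\<integral>x. F x * exp (real n * h x) \<partial>lborel) / D n - L = ((\<integral>x. F x * exp (real n * h x) \<partial>lborel) - L * D n) / D n"
      using Dpos by (simp add: field_simps)
    ultimately show "norm ((\<integral>x. F x * exp (real n * h x) \<partial>lborel) / (\<integral>x. exp (real n * h x) \<partial>lborel) - L) < e"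
      unfolding D_def[symmetric] using Dpos by (simp add: abs_divide pos_divide_less_eq)
  qed
qed

lemma norm_cis_diff_le: "norm (cis a - cis b) \<le> \<bar>a - b\<bar>"
proof -
  have "cis a - cis b = cis b * (iexp (a - b) - 1)"
    by (simp only: cis_conv_exp[symmetric] right_diff_distrib cis_mult) simp
  then show ?thesis
    using iexp_approx1[of "a - b" 0] by (simp add: norm_mult)
qed

text \<open>
  For \<open>s = t / n\<close> the right-hand side vanishes as \<open>n\<close> grows, and it does not depend on \<open>\<tau>\<close>: a sum of \<open>n\<close> independent spins with
  mean \<open>\<tau>\<close>, divided by \<open>n\<close>, behaves like \<open>\<tau>\<close> uniformly in \<open>\<tau>\<close>.
\<close>
lemma tilted_spin_char_power_near_cis:
  fixes s t \<tau> :: real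
  assumes \<tau>: "\<bar>\<tau>\<bar> \<le> 1"
  shows "norm (Complex (cos s) (\<tau> * sin s) ^ n - cis (t * \<tau>))
    \<le> real n * (s\<^sup>2 * (s\<^sup>2 + 1) * exp 2) + \<bar>exp (real n * (cos s - 1)) - 1\<bar> + \<bar>real n * sin s - t\<bar>"
    (is "norm (?\<phi> - _) \<le> ?err")
proof -
  have \<tau>2: "\<tau>\<^sup>2 \<le> 1" using \<tau> by (simp add: abs_square_le_1)
  let ?E = "complex_of_real (exp (real n * (cos s - 1)))"
  let ?c = "cis (real n * \<tau> * sin s)"
  have "norm (?\<phi> - ?E * ?c) \<le> real n * (s\<^sup>2 * (s\<^sup>2 + \<tau>\<^sup>2) * exp 2)"
    using tilted_spin_char_power[OF \<tau>, of s n] by (simp only: exp_of_real)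
  also have "\<dots> \<le> real n * (s\<^sup>2 * (s\<^sup>2 + 1) * exp 2)"
    using \<tau>2 by (intro mult_left_mono mult_right_mono add_left_mono) auto
  finally have 1: "norm (?\<phi> - ?E * ?c) \<le> real n * (s\<^sup>2 * (s\<^sup>2 + 1) * exp 2)" .
  have "norm ((?E - 1) * ?c) = norm (complex_of_real (exp (real n * (cos s - 1)) - 1))"
    by (simp add: norm_mult)
  then have 2: "norm ((?E - 1) * ?c) = \<bar>exp (real n * (cos s - 1)) - 1\<bar>"
    by (simp only: norm_of_real)
  have "norm (?c - cis (t * \<tau>)) \<le> \<bar>real n * \<tau> * sin s - t * \<tau>\<bar>"
    by (rule norm_cis_diff_le)
  also have "\<dots> = \<bar>\<tau>\<bar> * \<bar>real n * sin s - t\<bar>"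
    by (simp add: abs_mult[symmetric] algebra_simps)
  also have "\<dots> \<le> \<bar>real n * sin s - t\<bar>"
    using \<tau> by (simp add: mult_left_le_one_le)
  finally have 3: "norm (?c - cis (t * \<tau>)) \<le> \<bar>real n * sin s - t\<bar>" .
  have "?\<phi> - cis (t * \<tau>) = (?\<phi> - ?E * ?c) + (?E - 1) * ?c + (?c - cis (t * \<tau>))"
    by (simp add: algebra_simps)
  also have "norm \<dots> \<le> ?err"
    using 1 2 3 by (intro norm_triangle_mono) auto
  finally show ?thesis .
qed

text \<open>
  The function \<open>h v = ln cosh v - v\<^sup>2 / (2 \<beta>)\<close> is even with derivative \<open>tanh v - v / \<beta>\<close>, so outside a neighbourhood of
  \<open>{- u, u}\<close> it is at most the larger of its values at the boundary points. The observable \<open>cos (t tanh x)\<close> is even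
  and takes the same value at \<open>u\<close> and \<open>- u\<close>.
\<close>
lemma supercritical_mean_cos_tendsto:
  fixes \<beta> t u :: real
  assumes \<beta>: "0 < \<beta>" and u: "0 < u"
    and below: "\<And>v. 0 < v \<Longrightarrow> v < u \<Longrightarrow> v / \<beta> < tanh v" and above: "\<And>v. u < v \<Longrightarrow> tanh v < v / \<beta>"
  shows "(\<lambda>n. (\<integral>x. cos (t * tanh x) * exp (real n * (ln (cosh x) - x\<^sup>2 / (2 * \<beta>))) \<partial>lborel)
      / (\<integral>x. exp (real n * (ln (cosh x) - x\<^sup>2 / (2 * \<beta>))) \<partial>lborel)) \<longlonglongrightarrow> cos (t * tanh u)"
proof (rule laplace_concentration[where p = u])
  define h where "h x = ln (cosh x) - x\<^sup>2 / (2 * \<beta>)" for x :: real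
  have h_abs: "h \<bar>x\<bar> = h x" for x by (simp add: h_def)
  have deriv: "(h has_real_derivative (tanh x - x / \<beta>)) (at x)" for x
    unfolding h_def[abs_def] using \<beta> by (auto intro!: derivative_eq_intros simp: tanh_def)
  have incr: "h x < h y" if "0 \<le> x" "x < y" "y \<le> u" for x y
  proof (rule DERIV_pos_imp_increasing_open[OF that(2)])
    show "\<exists>d. (h has_real_derivative d) (at v) \<and> 0 < d" if "x < v" "v < y" for v
      using deriv[of v] below[of v] that \<open>0 \<le> x\<close> \<open>y \<le> u\<close> by (intro exI[of _ "tanh v - v / \<beta>"]) auto
    show "continuous_on {x..y} h"
      by (intro continuous_at_imp_continuous_on ballI DERIV_isCont[OF deriv])
  qed
  have decr: "h y < h x" if "u \<le> x" "x < y" for x y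
  proof (rule DERIV_neg_imp_decreasing_open[OF that(2)])
    show "\<exists>d. (h has_real_derivative d) (at v) \<and> d < 0" if "x < v" "v < y" for v
      using deriv[of v] above[of v] that \<open>u \<le> x\<close> by (intro exI[of _ "tanh v - v / \<beta>"]) auto
    show "continuous_on {x..y} h"
      by (intro continuous_at_imp_continuous_on ballI DERIV_isCont[OF deriv])
  qed
  show "continuous_on UNIV (\<lambda>x. ln (cosh x) - x\<^sup>2 / (2 * \<beta>))"
    using \<beta> by (intro continuous_intros) auto
  show "integrable lborel (\<lambda>x. exp (real n * (ln (cosh x) - x\<^sup>2 / (2 * \<beta>))))" if "0 < n" for n
  proof -
    have "integrable lborel (\<lambda>x. cosh (1 * x) ^ n * exp (- (real n / (2 * \<beta>)) * x\<^sup>2))"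
      using \<beta> that by (intro hubbard_stratonovich(2)[where \<beta> = \<beta>]) auto
    also have "(\<lambda>x. cosh (1 * x) ^ n * exp (- (real n / (2 * \<beta>)) * x\<^sup>2))
        = (\<lambda>x. exp (real n * (ln (cosh x) - x\<^sup>2 / (2 * \<beta>))))"
      by (simp add: right_diff_distrib exp_diff exp_of_nat_mult exp_minus field_simps)
    finally show ?thesis .
  qed
  show "(\<lambda>x. cos (t * tanh x)) \<in> borel_measurable borel"
    by (intro borel_measurable_continuous_onI continuous_intros) auto
  fix \<epsilon> :: real
  assume "0 < \<epsilon>"
  have "isCont (\<lambda>x. cos (t * tanh x)) u"
    by (intro continuous_intros) auto
  then have "\<exists>\<delta>>0. \<forall>x. norm (x - u) < \<delta> \<longrightarrow> \<bar>cos (t * tanh x) - cos (t * tanh u)\<bar> < \<epsilon>"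
    using \<open>0 < \<epsilon>\<close> unfolding continuous_at_real_range by blast
  then obtain \<delta>' where \<delta>': "0 < \<delta>'" "\<And>x. \<bar>x - u\<bar> < \<delta>' \<Longrightarrow> \<bar>cos (t * tanh x) - cos (t * tanh u)\<bar> < \<epsilon>"
    by auto
  define \<delta> where "\<delta> = min \<delta>' u"
  have \<delta>: "0 < \<delta>" "\<delta> \<le> u" "\<delta> \<le> \<delta>'" using \<delta>' u by (auto simp: \<delta>_def)
  define \<eta> where "\<eta> = min (h u - h (u - \<delta>)) (h u - h (u + \<delta>))"
  have "0 < \<eta>"
    using incr[of "u - \<delta>" u] decr[of u "u + \<delta>"] \<delta> by (simp add: \<eta>_def)
  moreover have "h x \<le> h u - \<eta>" if "\<epsilon> \<le> \<bar>cos (t * tanh x) - cos (t * tanh u)\<bar>" for x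
  proof -
    have "cos (t * tanh \<bar>x\<bar>) = cos (t * tanh x)"
      by (cases "0 \<le> x") auto
    then have "\<not> \<bar>\<bar>x\<bar> - u\<bar> < \<delta>'" using \<delta>'(2)[of "\<bar>x\<bar>"] that by auto
    then consider "\<bar>x\<bar> \<le> u - \<delta>" | "u + \<delta> \<le> \<bar>x\<bar>" using \<delta>(3) by linarith
    then have "h \<bar>x\<bar> \<le> h u - \<eta>"
    proof cases
      case 1
      then have "h \<bar>x\<bar> \<le> h (u - \<delta>)"
        using incr[of "\<bar>x\<bar>" "u - \<delta>"] \<delta> by (cases "\<bar>x\<bar> = u - \<delta>") auto
      then show ?thesis by (simp add: \<eta>_def)
    next
      case 2
      then have "h \<bar>x\<bar> \<le> h (u + \<delta>)"
        using decr[of "u + \<delta>" "\<bar>x\<bar>"] \<delta> by (cases "\<bar>x\<bar> = u + \<delta>") auto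
      then show ?thesis by (simp add: \<eta>_def)
    qed
    then show ?thesis by (simp only: h_abs)
  qed
  ultimately show "\<exists>\<eta>>0. \<forall>x. \<epsilon> \<le> \<bar>cos (t * tanh x) - cos (t * tanh u)\<bar> \<longrightarrow>
      ln (cosh x) - x\<^sup>2 / (2 * \<beta>) \<le> ln (cosh u) - u\<^sup>2 / (2 * \<beta>) - \<eta>"
    by (auto simp: h_def)
qed auto

text \<open>
  By \<open>tilted_spin_char_power_near_cis\<close> the characteristic function of \<open>M / n\<close> is, up to a vanishing error, the mean of
  \<open>cis (t tanh x)\<close> under the field density \<open>exp (n h)\<close>. As \<open>h\<close> is even, the imaginary part integrates to \<open>0\<close> and the
  mean of the cosine remains, which converges to \<open>cos (t tanh u)\<close>, the characteristic function
  of \<open>tanh u\<close> times a fair sign.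
\<close>
lemma weak_conv_supercritical:
  fixes \<beta> :: real
  assumes "1 < \<beta>"
  shows "(\<exists>!t. 0 < t \<and> t = tanh (\<beta> * t))"
    and "weak_conv_m (\<lambda>n. distr (curie_weiss n \<beta>) borel (\<lambda>x. magnetisation n x / real n))
            (distr uniform_sign borel (\<lambda>b. tanh_root \<beta> * b))"
proof -
  have \<beta>: "0 < \<beta>" using assms by simp
  obtain u where u: "0 < u" "tanh u = u / \<beta>"
    and below: "\<And>v. 0 < v \<Longrightarrow> v < u \<Longrightarrow> v / \<beta> < tanh v" and above: "\<And>v. u < v \<Longrightarrow> tanh v < v / \<beta>"
    using tanh_fixed_point[OF assms] by blast
  have root: "0 < u / \<beta> \<and> u / \<beta> = tanh (\<beta> * (u / \<beta>))"
    using u \<beta> by simp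
  have unique: "t = u / \<beta>" if "0 < t \<and> t = tanh (\<beta> * t)" for t
  proof -
    have "0 < \<beta> * t" "tanh (\<beta> * t) = \<beta> * t / \<beta>" using that \<beta> by auto
    then have "\<beta> * t = u" using below[of "\<beta> * t"] above[of "\<beta> * t"] by (cases rule: linorder_cases[of "\<beta> * t" u]) auto
    then show ?thesis using \<beta> by (simp add: field_simps)
  qed
  show "\<exists>!t. 0 < t \<and> t = tanh (\<beta> * t)"
    using root unique by blast
  have tanh_root: "tanh_root \<beta> = tanh u"
    unfolding tanh_root_def u(2) using root unique by (rule the_equality)
  interpret U: prob_space uniform_sign by (rule prob_space_uniform_sign)
  show "weak_conv_m (\<lambda>n. distr (curie_weiss n \<beta>) borel (\<lambda>x. magnetisation n x / real n))
            (distr uniform_sign borel (\<lambda>b. tanh_root \<beta> * b))"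
  proof (rule weak_conv_curie_weiss)
    show "real_distribution (distr uniform_sign borel (\<lambda>b. tanh_root \<beta> * b))"
      by (rule U.real_distribution_distr) simp
  next
    fix t :: real
    have char_limit: "char (distr uniform_sign borel (\<lambda>b. tanh_root \<beta> * b)) t = of_real (cos (t * tanh u))"
    proof -
      have "char (distr uniform_sign borel (\<lambda>b. tanh_root \<beta> * b)) t = (\<integral>b. iexp (t * (tanh u * b)) \<partial>uniform_sign)"
        unfolding char_def tanh_root by (subst integral_distr) auto
      also have "\<dots> = (1 / 2) *\<^sub>R (iexp (t * (tanh u * 1)) + iexp (t * (tanh u * (- 1))))"
        by (rule integral_uniform_sign) measurable
      also have "\<dots> = of_real (cos (t * tanh u))"
        by (simp add: complex_eq_iff cis_conv_exp[symmetric] Re_exp Im_exp)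
      finally show ?thesis .
    qed
    define w where "w n x = exp (real n * (ln (cosh x) - x\<^sup>2 / (2 * \<beta>)))" for n and x :: real
    define \<phi> where "\<phi> n x = Complex (cos (t / real n)) (tanh x * sin (t / real n)) ^ n" for n and x :: real
    define err where "err n = real n * ((t / real n)\<^sup>2 * ((t / real n)\<^sup>2 + 1) * exp 2)
        + \<bar>exp (real n * (cos (t / real n) - 1)) - 1\<bar> + \<bar>real n * sin (t / real n) - t\<bar>" for n
    have w_eq: "cosh (1 * x) ^ n * exp (- (real n / (2 * \<beta>)) * x\<^sup>2) = w n x" for n x
      by (simp add: w_def right_diff_distrib exp_diff exp_of_nat_mult exp_minus field_simps)
    have int_w: "integrable lborel (w n)" if "0 < n" for n
      using hubbard_stratonovich(2)[of n "real n / (2 * \<beta>)" 1 \<beta>] that \<beta> unfolding w_eq by simp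
    have w_pos: "0 < w n x" for n x by (simp add: w_def)
    have meas_\<phi>: "\<phi> n \<in> borel_measurable borel" for n
      using borel_measurable_tilted_spin_char_power[of "t / real n" 1 n] by (simp add: \<phi>_def[abs_def])
    have \<phi>1: "norm (\<phi> n x) \<le> 1" for n x
      unfolding \<phi>_def by (rule norm_tilted_spin_char_power_le_1)
    have \<phi>_err: "norm (\<phi> n x - cis (t * tanh x)) \<le> err n" for n x
      unfolding \<phi>_def err_def by (rule tilted_spin_char_power_near_cis[OF abs_tanh_le_1])
    have err: "err \<longlonglongrightarrow> 0"
    proof -
      have s: "(\<lambda>n. t / real n) \<longlonglongrightarrow> 0" by (rule lim_const_over_n)
      have ns2: "(\<lambda>n. real n * (t / real n)\<^sup>2) \<longlonglongrightarrow> 0"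
      proof (rule Lim_transform_eventually)
        show "(\<lambda>n. t\<^sup>2 / real n) \<longlonglongrightarrow> 0" by (rule lim_const_over_n)
        show "\<forall>\<^sub>F n in sequentially. t\<^sup>2 / real n = real n * (t / real n)\<^sup>2"
          using eventually_gt_at_top[of 0] by eventually_elim (simp add: power2_eq_square)
      qed
      have c: "(\<lambda>n. real n * (cos (t / real n) - 1)) \<longlonglongrightarrow> 0 * (- 1 / 2)"
        by (rule tendsto_scaled[OF tendsto_cos_quadratic _ _ s ns2]) auto
      have d: "(\<lambda>n. real n * sin (t / real n)) \<longlonglongrightarrow> t * 1"
      proof (rule tendsto_scaled[OF tendsto_sin_linear _ _ s])
        show "(\<lambda>n. real n * (t / real n) ^ 1) \<longlonglongrightarrow> t"
          by (rule tendsto_eventually) (use eventually_gt_at_top[of 0] in eventually_elim, simp)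
      qed auto
      have "(\<lambda>n. real n * (t / real n)\<^sup>2 * (((t / real n)\<^sup>2 + 1) * exp 2)) \<longlonglongrightarrow> 0 * ((0\<^sup>2 + 1) * exp 2)"
        by (intro tendsto_mult tendsto_add tendsto_power tendsto_const ns2 s)
      moreover have "(\<lambda>n. \<bar>exp (real n * (cos (t / real n) - 1)) - 1\<bar>) \<longlonglongrightarrow> \<bar>exp (0 * (- 1 / 2)) - 1\<bar>"
        by (intro tendsto_rabs tendsto_diff tendsto_exp c tendsto_const)
      moreover have "(\<lambda>n. \<bar>real n * sin (t / real n) - t\<bar>) \<longlonglongrightarrow> \<bar>t * 1 - t\<bar>"
        by (intro tendsto_rabs tendsto_diff d tendsto_const)
      ultimately have "err \<longlonglongrightarrow> 0 * ((0\<^sup>2 + 1) * exp 2) + \<bar>exp (0 * (- 1 / 2)) - 1\<bar> + \<bar>t * 1 - t\<bar>"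
        unfolding err_def[abs_def] mult.assoc by (intro tendsto_add)
      then show ?thesis by simp
    qed
    have w_even: "w n (- x) = w n x" for n x by (simp add: w_def)
    have ratio_err: "norm (char (distr (curie_weiss n \<beta>) borel (\<lambda>x. magnetisation n x / real n)) t
        - of_real ((\<integral>x. cos (t * tanh x) * w n x \<partial>lborel) / (\<integral>x. w n x \<partial>lborel))) \<le> err n" if n: "0 < n" for n
    proof -
      let ?W = "\<integral>x. w n x \<partial>lborel"
      have [measurable]: "w n \<in> borel_measurable borel" using int_w[OF n] by auto
      have meas_cis: "(\<lambda>x. cis (t * tanh x)) \<in> borel_measurable borel"
        unfolding cis_conv_exp by (intro borel_measurable_continuous_onI continuous_intros) auto
      have int_cis: "integrable lborel (\<lambda>x. cis (t * tanh x) * complex_of_real (w n x))"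
        by (rule Bochner_Integration.integrable_bound[OF int_w[OF n]]) (use meas_cis in \<open>auto simp: norm_mult\<close>)
      have int_\<phi>: "integrable lborel (\<lambda>x. \<phi> n x * complex_of_real (w n x))"
        by (rule Bochner_Integration.integrable_bound[OF int_w[OF n]])
          (use meas_\<phi> \<phi>1 w_pos in \<open>auto simp: norm_mult less_imp_le mult_left_le_one_le\<close>)
      have Wpos: "0 < ?W"
      proof -
        have "?W \<noteq> 0" using int_w[OF n] w_pos by (intro integral_pos_imp_nonzero) (auto simp: less_imp_le)
        moreover have "0 \<le> ?W" using w_pos by (intro Bochner_Integration.integral_nonneg) (auto simp: less_imp_le)
        ultimately show ?thesis by simp
      qed
      have "(\<integral>x. cis (t * tanh x) * complex_of_real (w n x) \<partial>lborel) = of_real (\<integral>x. cos (t * tanh x) * w n x \<partial>lborel)"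
      proof -
        let ?I = "\<integral>x. cis (t * tanh x) * complex_of_real (w n x) \<partial>lborel"
        \<comment> \<open>The reflection \<open>x \<mapsto> - x\<close> conjugates the integrand, so the integral is real.\<close>
        have "?I = \<bar>- 1\<bar> *\<^sub>R (\<integral>x. cis (t * tanh (0 + (- 1) * x)) * complex_of_real (w n (0 + (- 1) * x)) \<partial>lborel)"
          by (rule lborel_integral_real_affine) simp
        then have I: "?I = (\<integral>x. cnj (cis (t * tanh x) * complex_of_real (w n x)) \<partial>lborel)"
          by (simp add: w_even cis_cnj)
        also have "\<dots> = cnj ?I" by (rule Bochner_Integration.integral_cnj)
        finally have "Im ?I = 0" by (simp add: complex_eq_iff)
        moreover have "Re ?I = (\<integral>x. Re (cis (t * tanh x) * complex_of_real (w n x)) \<partial>lborel)"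
          by (rule Bochner_Integration.integral_Re[symmetric, OF int_cis])
        ultimately show ?thesis by (simp add: complex_eq_iff)
      qed
      moreover have "char (distr (curie_weiss n \<beta>) borel (\<lambda>x. magnetisation n x / real n)) t
          = (\<integral>x. \<phi> n x * of_real (w n x) \<partial>lborel) / of_real ?W"
        using char_curie_weiss[of n "real n / (2 * \<beta>)" 1 \<beta> "real n" t] n \<beta> unfolding w_eq by (simp add: \<phi>_def)
      ultimately have "char (distr (curie_weiss n \<beta>) borel (\<lambda>x. magnetisation n x / real n)) t
        - of_real ((\<integral>x. cos (t * tanh x) * w n x \<partial>lborel) / ?W)
        = ((\<integral>x. \<phi> n x * of_real (w n x) \<partial>lborel) - (\<integral>x. cis (t * tanh x) * complex_of_real (w n x) \<partial>lborel)) / of_real ?W"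
        by (simp add: diff_divide_distrib)
      also have "(\<integral>x. \<phi> n x * of_real (w n x) \<partial>lborel) - (\<integral>x. cis (t * tanh x) * complex_of_real (w n x) \<partial>lborel)
        = (\<integral>x. \<phi> n x * of_real (w n x) - cis (t * tanh x) * complex_of_real (w n x) \<partial>lborel)"
        by (rule Bochner_Integration.integral_diff[symmetric, OF int_\<phi> int_cis])
      also have "norm (\<dots> / of_real ?W) \<le> err n"
      proof -
        have "norm (\<integral>x. \<phi> n x * of_real (w n x) - cis (t * tanh x) * complex_of_real (w n x) \<partial>lborel)
            \<le> (\<integral>x. err n * w n x \<partial>lborel)"
        proof (rule Bochner_Integration.integral_norm_bound_integral)
          show "norm (\<phi> n x * of_real (w n x) - cis (t * tanh x) * complex_of_real (w n x)) \<le> err n * w n x" for x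
          proof -
            have "\<phi> n x * of_real (w n x) - cis (t * tanh x) * complex_of_real (w n x) = (\<phi> n x - cis (t * tanh x)) * of_real (w n x)"
              by (simp add: left_diff_distrib)
            then have "norm (\<phi> n x * of_real (w n x) - cis (t * tanh x) * complex_of_real (w n x)) = norm (\<phi> n x - cis (t * tanh x)) * w n x"
              using w_pos[of n x] by (simp add: norm_mult)
            then show ?thesis using \<phi>_err[of n x] w_pos[of n x] by (simp add: mult_right_mono)
          qed
        qed (use int_\<phi> int_cis int_w[OF n] in auto)
        then show ?thesis using Wpos by (simp add: norm_divide pos_divide_le_eq)
      qed
      finally show ?thesis .
    qed
    have "(\<lambda>n. char (distr (curie_weiss n \<beta>) borel (\<lambda>x. magnetisation n x / real n)) t
        - of_real ((\<integral>x. cos (t * tanh x) * w n x \<partial>lborel) / (\<integral>x. w n x \<partial>lborel))) \<longlonglongrightarrow> 0"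
      by (rule Lim_null_comparison[OF _ err]) (use eventually_gt_at_top[of 0] in eventually_elim, rule ratio_err)
    moreover have "(\<lambda>n. complex_of_real ((\<integral>x. cos (t * tanh x) * w n x \<partial>lborel) / (\<integral>x. w n x \<partial>lborel))) \<longlonglongrightarrow> of_real (cos (t * tanh u))"
      unfolding w_def by (intro tendsto_of_real supercritical_mean_cos_tendsto \<beta> u(1) below above)
    ultimately show "(\<lambda>n. char (distr (curie_weiss n \<beta>) borel (\<lambda>x. magnetisation n x / real n)) t)
        \<longlonglongrightarrow> char (distr uniform_sign borel (\<lambda>b. tanh_root \<beta> * b)) t"
      unfolding char_limit using tendsto_add by fastforce
  qed
qed

section \<open>The four limit laws\<close>

theorem theorem1p1:
  shows
    "(\<forall>\<beta>::real. 0 \<le> \<beta> \<and> \<beta> < 1 \<longrightarrow>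
        weak_conv_m
          (\<lambda>n. distr (curie_weiss n \<beta>) borel (\<lambda>x. magnetisation n x / sqrt (real n)))
          (density lborel (\<lambda>x. ennreal (normal_density 0 (sqrt (1 / (1 - \<beta>))) x))))
   \<and> weak_conv_m
        (\<lambda>n. distr (curie_weiss n 1) borel (\<lambda>x. magnetisation n x / real n powr (3 / 4)))
        (quartic_law 0)
   \<and> (\<forall>(\<Omega> :: 'a measure) (B :: 'a \<Rightarrow> real) (G :: 'a \<Rightarrow> real).
        prob_space \<Omega> \<and> prob_space.indep_var \<Omega> borel B borel G
          \<and> distr \<Omega> borel B = uniform_sign \<and> distr \<Omega> borel G = gamma_law (1 / 4) \<longrightarrow>
        distr \<Omega> borel (\<lambda>\<omega>. B \<omega> * (12 * G \<omega>) powr (1 / 4)) = quartic_law 0)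
   \<and> (\<forall>\<gamma>::real.
        weak_conv_m
          (\<lambda>n. distr (curie_weiss n (1 - \<gamma> / sqrt (real n))) borel
                 (\<lambda>x. magnetisation n x / real n powr (3 / 4)))
          (quartic_law \<gamma>))
   \<and> (\<forall>\<beta>::real. 1 < \<beta> \<longrightarrow>
        (\<exists>!t. 0 < t \<and> t = tanh (\<beta> * t))
        \<and> weak_conv_m
            (\<lambda>n. distr (curie_weiss n \<beta>) borel (\<lambda>x. magnetisation n x / real n))
            (distr uniform_sign borel (\<lambda>b. tanh_root \<beta> * b)))"
proof (intro conjI allI impI)
  show "weak_conv_m
          (\<lambda>n. distr (curie_weiss n \<beta>) borel (\<lambda>x. magnetisation n x / sqrt (real n)))
          (density lborel (\<lambda>x. ennreal (normal_density 0 (sqrt (1 / (1 - \<beta>))) x)))"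
    if "0 \<le> \<beta> \<and> \<beta> < 1" for \<beta> :: real
    using that by (intro weak_conv_subcritical) auto
  show "weak_conv_m
        (\<lambda>n. distr (curie_weiss n 1) borel (\<lambda>x. magnetisation n x / real n powr (3 / 4)))
        (quartic_law 0)"
    using weak_conv_critical_window[of 0] by simp
  show "distr \<Omega> borel (\<lambda>\<omega>. B \<omega> * (12 * G \<omega>) powr (1 / 4)) = quartic_law 0"
    if "prob_space \<Omega> \<and> prob_space.indep_var \<Omega> borel B borel G
          \<and> distr \<Omega> borel B = uniform_sign \<and> distr \<Omega> borel G = gamma_law (1 / 4)"
    for \<Omega> :: "'a measure" and B G :: "'a \<Rightarrow> real"
    using that by (intro quartic_law_representation) auto
  show "weak_conv_m
          (\<lambda>n. distr (curie_weiss n (1 - \<gamma> / sqrt (real n))) borel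
                 (\<lambda>x. magnetisation n x / real n powr (3 / 4)))
          (quartic_law \<gamma>)" for \<gamma> :: real
    by (rule weak_conv_critical_window)
  show "\<exists>!t. 0 < t \<and> t = tanh (\<beta> * t)" if "1 < \<beta>" for \<beta> :: real
    using that by (rule weak_conv_supercritical)
  show "weak_conv_m
            (\<lambda>n. distr (curie_weiss n \<beta>) borel (\<lambda>x. magnetisation n x / real n))
            (distr uniform_sign borel (\<lambda>b. tanh_root \<beta> * b))" if "1 < \<beta>" for \<beta> :: real
    using that by (rule weak_conv_supercritical)
qed

end
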